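(* Let $(a_1,\ldots,a_n)$ be a rational tangle word ($n\geq 1$, $a_i\in\mathbb{Z}$), and suppose that one of the two closures (numerator or denominator) of the rational tangle $(a_1,\ldots,a_n)$ is a 2-component link diagram. Consider the Linking-Unlinking Game played on the shadow of this 2-component closure. (1) If $a_{2k+1}=0$ for all $k$ (i.e. every odd-indexed syllable is $0$), then the Unlinker wins (however the game is played and whoever moves first). (2) If either (a) $a_{2k+1}\neq 0$ for at least one $k$ and all of the $a_i$ are even, (b) $n=2$ and both $a_1$ and $a_2$ are odd, or (c) $n\geq 3$, both $a_1$ and $a_n$ are odd, and all other $a_i$ are even, then the second player has a winning strategy, regardless of whether the second player is the Linker or the Unlinker.
   Context: Link projections. A link shadow is a projection of a link to the plane $\mathbb{R}^2$ in which all crossings are transverse double points, with no over/under information. Resolving a crossing means choosing which of its two strands is the overstrand; each crossing has two possible resolutions. A link diagram is a link shadow all of whose crossings have been resolved. Two link diagrams are equivalent if they are related by a finite sequence of Reidemeister moves and planar isotopies. A link diagram is splittable if it is equivalent to a diagram in which one or more components lie entirely inside a circle in the plane and the other components lie entirely outside it; otherwise it is unsplittable. The Linking-Unlinking Game. It is a two-player game played on the shadow of a 2-component link. Players alternately choose an unresolved crossing and resolve it, until all crossings are resolved and a 2-component link diagram is formed. One player, the Linker, wins if the resulting diagram is unsplittable; the other player, the Unlinker, wins if it is splittable. Either of the two players may move first; the "second player" is the one who does not make the first move. A player has a winning strategy if they can force a win regardless of the opponent's moves. Rational tangles. For integers $a_1,\ldots,a_n$, the rational tangle $(a_1,\ldots,a_n)$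 is the tangle diagram with four endpoints NW, NE, SW, SE constructed as follows. Start with two parallel vertical strands (one joining NW to SW, the other joining NE to SE). Read the word from left to right: first twist the bottom two endpoints (SW, SE) about each other $|a_1|$ times (half-twists, one crossing each), then twist the right two endpoints (NE, SE) $|a_2|$ times, then the bottom two endpoints $|a_3|$ times, and so on, alternating: even-indexed syllables twist the right two endpoints, odd-indexed syllables twist the bottom two endpoints. If $a_i>0$ (resp. $a_i<0$), the overstrand at each crossing of the $i$th syllable has positive (resp. negative) slope. The $a_i$ are the syllables of the rational tangle word. The numerator closure connects NW to NE and SW to SE; the denominator closure connects NW to SW and NE to SE (outside the tangle, without new crossings). *)

theory Defs
  imports Main
begin

section \<open>Shadows and diagrams as words of horizontal slices\<close>

text \<open>
  A planar tangle projection, put in general position with respect to the height function of the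
  plane, is read from top to bottom as a sequence of horizontal slices. Each slice contains exactly
  one local maximum (\<open>Cap\<close>), local minimum (\<open>Cup\<close>) or double point (\<open>Cross\<close>), all other strands
  passing straight through. The letter \<open>(i, b)\<close> is the slice with feature \<open>b\<close> and exactly \<open>i\<close>
  strands to the left of it. Every shadow or diagram in the plane is represented, up to planar
  isotopy, by such a word.

  The label of a crossing is \<open>()\<close> in a shadow. In a diagram it is a Boolean, where \<open>True\<close> means
  that the overstrand has positive slope, and \<open>False\<close> that it has negative slope.
\<close>

datatype 'c brick = Cap | Cup | Cross 'c

type_synonym 'c word = "(nat \<times> 'c brick) list"
type_synonym shadow = "unit word"
type_synonym diagram = "bool word"

fun ins :: "'c brick \<Rightarrow> nat" where
  "ins Cap = 0"
| "ins Cup = 2"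
| "ins (Cross c) = 2"

fun outs :: "'c brick \<Rightarrow> nat" where
  "outs Cap = 2"
| "outs Cup = 0"
| "outs (Cross c) = 2"

text \<open>\<open>tangle_word m w n\<close>: the word is a tangle projection with \<open>m\<close> top and \<open>n\<close> bottom endpoints.\<close>

fun tangle_word :: "nat \<Rightarrow> 'c word \<Rightarrow> nat \<Rightarrow> bool" where
  "tangle_word m [] n \<longleftrightarrow> m = n"
| "tangle_word m ((i, b) # w) n \<longleftrightarrow> i + ins b \<le> m \<and> tangle_word (m - ins b + outs b) w n"

definition link_word :: "'c word \<Rightarrow> bool" where
  "link_word w \<longleftrightarrow> tangle_word 0 w 0"

text \<open>\<open>translate k w\<close> places \<open>w\<close> to the right of \<open>k\<close> further strands.\<close>

definition translate :: "nat \<Rightarrow> 'c word \<Rightarrow> 'c word" where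
  "translate k w = map (\<lambda>(i, b). (k + i, b)) w"

definition shadow_of :: "'c word \<Rightarrow> shadow" where
  "shadow_of w = map (map_prod id (map_brick (\<lambda>_. ()))) w"


section \<open>Components\<close>

text \<open>
  The number of strands on the horizontal line just above slice \<open>k\<close>, for a word without top
  endpoints. The strand number \<open>p\<close> (from the left, starting with 0) on this line is the point
  \<open>(k, p)\<close>. Every component of a link projection passes through such a point.
\<close>

definition width :: "'c word \<Rightarrow> nat \<Rightarrow> nat" where
  "width w k = fold (\<lambda>(i, b) m. m - ins b + outs b) (take k w) 0"

definition points :: "'c word \<Rightarrow> (nat \<times> nat) set" where
  "points w = {(k, p). k \<le> length w \<and> p < width w k}"

inductive strand_step :: "'c word \<Rightarrow> nat \<times> nat \<Rightarrow> nat \<times> nat \<Rightarrow> bool" for w where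
  left: "k < length w \<Longrightarrow> w ! k = (i, b) \<Longrightarrow> p < i \<Longrightarrow> strand_step w (k, p) (Suc k, p)"
| right: "k < length w \<Longrightarrow> w ! k = (i, b) \<Longrightarrow> i + ins b + p < width w k
    \<Longrightarrow> strand_step w (k, i + ins b + p) (Suc k, i + outs b + p)"
| cap: "k < length w \<Longrightarrow> w ! k = (i, Cap) \<Longrightarrow> strand_step w (Suc k, i) (Suc k, i + 1)"
| cup: "k < length w \<Longrightarrow> w ! k = (i, Cup) \<Longrightarrow> strand_step w (k, i) (k, i + 1)"
| cross_falling: "k < length w \<Longrightarrow> w ! k = (i, Cross c) \<Longrightarrow> strand_step w (k, i) (Suc k, i + 1)"
| cross_rising: "k < length w \<Longrightarrow> w ! k = (i, Cross c) \<Longrightarrow> strand_step w (k, i + 1) (Suc k, i)"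

definition components :: "'c word \<Rightarrow> (nat \<times> nat) set set" where
  "components w = points w // {(x, y). equivclp (strand_step w) x y}"

definition two_component_link :: "'c word \<Rightarrow> bool" where
  "two_component_link w \<longleftrightarrow> link_word w \<and> card (components w) = 2"


section \<open>Planar isotopy and Reidemeister moves\<close>

text \<open>
  Planar isotopy of sliced diagrams is generated by exchanging the heights of two distant
  features, by creating or removing a maximum and a minimum on a strand, and by
  sliding a crossing past the local extremum of one of its two strands. A slide rotates the
  crossing, so that the slope of its overstrand changes sign.
\<close>

inductive isotopy_move :: "diagram \<Rightarrow> diagram \<Rightarrow> bool" where
  exchange: "isotopy_move [(i, b), (i + outs b + k, b')] [(i + ins b + k, b'), (i, b)]"
| zigzag_left: "isotopy_move [(i, Cap), (i + 1, Cup)] []"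
| zigzag_right: "isotopy_move [(i + 1, Cap), (i, Cup)] []"
| slide_cap: "isotopy_move [(i, Cap), (i + 1, Cross c)] [(i + 1, Cap), (i, Cross (\<not> c))]"
| slide_cup: "isotopy_move [(i + 1, Cross c), (i, Cup)] [(i, Cross (\<not> c)), (i + 1, Cup)]"

text \<open>
  The other positions of the first two Reidemeister moves in the plane are obtained from those
  given by planar isotopy. In the third move, the condition on the labels says that one of the
  three strands lies above, and one below, the two others.
\<close>

inductive reidemeister_move :: "diagram \<Rightarrow> diagram \<Rightarrow> bool" where
  R1_cap: "reidemeister_move [(i, Cap), (i, Cross c)] [(i, Cap)]"
| R1_cup: "reidemeister_move [(i, Cross c), (i, Cup)] [(i, Cup)]"
| R2: "reidemeister_move [(i, Cross c), (i, Cross (\<not> c))] []"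
| R3: "c\<^sub>2 = c\<^sub>1 \<or> c\<^sub>2 = c\<^sub>3 \<Longrightarrow>
    reidemeister_move [(i, Cross c\<^sub>1), (i + 1, Cross c\<^sub>2), (i, Cross c\<^sub>3)]
                      [(i + 1, Cross c\<^sub>3), (i, Cross c\<^sub>2), (i + 1, Cross c\<^sub>1)]"

inductive diagram_move :: "diagram \<Rightarrow> diagram \<Rightarrow> bool" where
  "isotopy_move l r \<or> reidemeister_move l r \<Longrightarrow> link_word (u @ l @ v) \<Longrightarrow> link_word (u @ r @ v)
    \<Longrightarrow> diagram_move (u @ l @ v) (u @ r @ v)"

definition equivalent :: "diagram \<Rightarrow> diagram \<Rightarrow> bool" where
  "equivalent = equivclp diagram_move"

text \<open>
  After a planar isotopy, the circle that separates the components is the boundary of a rectangle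
  occupying a range of heights of its own, with \<open>k\<close> strands passing to the left of it. The inside
  \<open>w\<close> and the outside \<open>u @ v\<close> both contain at least one component.
\<close>

definition splittable :: "diagram \<Rightarrow> bool" where
  "splittable D \<longleftrightarrow> (\<exists>u w v k. equivalent D (u @ translate k w @ v)
     \<and> link_word (u @ translate k w @ v) \<and> link_word w \<and> w \<noteq> [] \<and> link_word (u @ v) \<and> u @ v \<noteq> [])"


section \<open>The Linking-Unlinking Game\<close>

text \<open>
  A crossing is identified by its index in the word. A move consists of an unresolved crossing and
  the label it receives; a play is the list of the moves made so far.
\<close>

datatype player = Linker | Unlinker

fun opponent :: "player \<Rightarrow> player" where
  "opponent Linker = Unlinker"
| "opponent Unlinker = Linker"

type_synonym play = "(nat \<times> bool) list"

definition crossings :: "'c word \<Rightarrow> nat set" where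
  "crossings w = {k. k < length w \<and> (\<exists>i c. w ! k = (i, Cross c))}"

definition legal_play :: "shadow \<Rightarrow> play \<Rightarrow> bool" where
  "legal_play S h \<longleftrightarrow> distinct (map fst h) \<and> fst ` set h \<subseteq> crossings S"

definition complete_play :: "shadow \<Rightarrow> play \<Rightarrow> bool" where
  "complete_play S h \<longleftrightarrow> distinct (map fst h) \<and> fst ` set h = crossings S"

definition resolve :: "shadow \<Rightarrow> (nat \<Rightarrow> bool) \<Rightarrow> diagram" where
  "resolve S r = map (\<lambda>k. map_prod id (map_brick (\<lambda>_. r k)) (S ! k)) [0..<length S]"

definition outcome :: "shadow \<Rightarrow> play \<Rightarrow> diagram" where
  "outcome S h = resolve S (\<lambda>k. the (map_of h k))"

fun wins :: "player \<Rightarrow> diagram \<Rightarrow> bool" where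
  "wins Linker D \<longleftrightarrow> \<not> splittable D"
| "wins Unlinker D \<longleftrightarrow> splittable D"

definition to_move :: "player \<Rightarrow> play \<Rightarrow> player" where
  "to_move first h = (if even (length h) then first else opponent first)"

definition follows :: "(play \<Rightarrow> nat \<times> bool) \<Rightarrow> player \<Rightarrow> player \<Rightarrow> play \<Rightarrow> bool" where
  "follows \<sigma> first P h \<longleftrightarrow> (\<forall>k < length h. to_move first (take k h) = P \<longrightarrow> h ! k = \<sigma> (take k h))"

text \<open>
  Player \<open>P\<close> has a winning strategy in the game in which player \<open>first\<close> makes the first move. The
  first conjunct requires the strategy to prescribe a legal move whenever it is consulted.
\<close>

definition has_winning_strategy :: "shadow \<Rightarrow> player \<Rightarrow> player \<Rightarrow> bool" where
  "has_winning_strategy S first P \<longleftrightarrow> (\<exists>\<sigma>.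
     (\<forall>h. legal_play S h \<and> \<not> complete_play S h \<and> follows \<sigma> first P h \<and> to_move first h = P
        \<longrightarrow> legal_play S (h @ [\<sigma> h])) \<and>
     (\<forall>h. complete_play S h \<and> follows \<sigma> first P h \<longrightarrow> wins P (outcome S h)))"


section \<open>Rational tangles\<close>

text \<open>
  A tangle has the top endpoints NW, NE and the bottom endpoints SW, SE. In a twist of the right
  two endpoints, the old NE is bent down by a cap and the old SE is bent up by a cup, so that
  they become the left two ends of the new crossing, whose right two ends are the new NE and SE.
\<close>

definition bottom_twist :: "bool \<Rightarrow> diagram \<Rightarrow> diagram" where
  "bottom_twist c T = T @ [(0, Cross c)]"

definition right_twist :: "bool \<Rightarrow> diagram \<Rightarrow> diagram" where
  "right_twist c T = [(1, Cap)] @ T @ [(2, Cross c), (1, Cup)]"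

definition add_syllable :: "nat \<times> int \<Rightarrow> diagram \<Rightarrow> diagram" where
  "add_syllable = (\<lambda>(i, a). (if odd i then bottom_twist (a > 0) else right_twist (a > 0)) ^^ nat \<bar>a\<bar>)"

definition rational_tangle :: "int list \<Rightarrow> diagram" where
  "rational_tangle as = fold add_syllable (enumerate 1 as) []"

definition numerator_closure :: "diagram \<Rightarrow> diagram" where
  "numerator_closure T = [(0, Cap)] @ T @ [(0, Cup)]"

definition denominator_closure :: "diagram \<Rightarrow> diagram" where
  "denominator_closure T = [(0, Cap), (2, Cap)] @ translate 1 T @ [(0, Cup), (0, Cup)]"

end

theory Submission
  imports Defs
begin

text \<open>
  Twisting the same ends of a tangle twice with opposite labels does nothing, up to the second
  Reidemeister move. If all syllables are even, the crossings are therefore paired as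
  \<open>(0, 1), (2, 3), \<dots>\<close> in the order of twisting; if only the first and the last syllable are odd, then
  as \<open>(1, 2), (3, 4), \<dots>\<close> together with the first and the last crossing. The second player always
  answers in the other crossing of the pair. The Unlinker answers with the opposite label, so that
  everything cancels. The Linker does the same except in one pair, consisting of crossings of the
  two components, in which he repeats the label. Then the linking number is odd. Modulo 2 it
  counts the crossings at which the first component is above the second one, so that no
  orientation is needed, and it is computed for all colourings of the strands by two colours,
  slice by slice. The colourings also show which of the two closures has two components.
\<close>

section \<open>Tangle words\<close>

text \<open>The outcome depends on the opponent's labels, so one invariant has to settle all plays
  of a strategy at once. The set of attainable pairs \<open>(v, U)\<close> of parity and colours is
  left unchanged by every move, so no component has to be followed through a move, and a split
  diagram attains \<open>(False, UNIV)\<close>: \<open>True\<close> inside the circle,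
  \<open>False\<close> outside. In a closed rational tangle the colours of the two initial vertical
  strands force all others, so the parity is computed twist by twist. Repeating a label makes it odd
  because the strands change places between the two crossings of a pair: equal slopes put each
  strand on top once. In an all-even word a pair of right twists would not do, since NE and SE have
  the same colour there; hence the demand for a nonzero syllable of odd index. Twists of the right
  ends of the untwisted tangle are mere kinks, which gives (1). In (c) the first and the last
  crossing cancel inside the tangle if \<open>n\<close> is odd; if \<open>n\<close> is even they are
  of different kinds and meet only after the numerator closure.\<close>

lemma tangle_word_append:
  "tangle_word m (x @ y) n \<longleftrightarrow> (\<exists>k. tangle_word m x k \<and> tangle_word k y n)"
  by (induction m x n arbitrary: rule: tangle_word.induct) auto

lemma tangle_word_unique: "tangle_word m w n \<Longrightarrow> tangle_word m w n' \<longleftrightarrow> n' = n"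
  by (induction m w n rule: tangle_word.induct) auto

lemma translate_simps [simp]:
  "translate k [] = []"
  "translate k ((i, b) # w) = (k + i, b) # translate k w"
  "translate k (x @ y) = translate k x @ translate k y"
  by (auto simp: translate_def)

lemma translate_0 [simp]: "translate 0 w = w"
  by (auto simp: translate_def)

lemma tangle_word_widen:
  "tangle_word m w n \<Longrightarrow> tangle_word (k + m + j) (translate k w) (k + n + j)"
proof (induction m w n rule: tangle_word.induct)
  case (2 m i b w n)
  then have le: "k + i + ins b \<le> k + m + j"
    and eq: "k + m + j - ins b + outs b = k + (m - ins b + outs b) + j"
    by auto
  have "tangle_word (k + (m - ins b + outs b) + j) (translate k w) (k + n + j)"
    using 2(1) 2(2)[unfolded tangle_word.simps] by blast
  then show ?case using le by (simp only: translate_simps tangle_word.simps eq)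
qed simp

lemma tangle_word_widen_right: "tangle_word m w n \<Longrightarrow> tangle_word (m + j) w (n + j)"
  using tangle_word_widen[of m w n 0 j] by simp


section \<open>Equivalence of tangles\<close>

text \<open>Cancellations happen in the interior of a tangle, while \<open>diagram_move\<close>
  speaks of closed words only. For \<open>m = n = 0\<close> the two relations agree.\<close>

inductive tangle_move :: "nat \<Rightarrow> nat \<Rightarrow> diagram \<Rightarrow> diagram \<Rightarrow> bool" for m n where
  "isotopy_move l r \<or> reidemeister_move l r \<Longrightarrow> tangle_word m (u @ l @ v) n
    \<Longrightarrow> tangle_word m (u @ r @ v) n \<Longrightarrow> tangle_move m n (u @ l @ v) (u @ r @ v)"

definition tangle_equiv :: "nat \<Rightarrow> nat \<Rightarrow> diagram \<Rightarrow> diagram \<Rightarrow> bool" where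
  "tangle_equiv m n = equivclp (tangle_move m n)"

lemma tangle_equiv_refl [simp]: "tangle_equiv m n x x"
  by (simp add: tangle_equiv_def)

lemma tangle_equiv_sym: "tangle_equiv m n x y \<Longrightarrow> tangle_equiv m n y x"
  unfolding tangle_equiv_def by (rule equivclp_sym)

lemma tangle_equiv_trans [trans]:
  "tangle_equiv m n x y \<Longrightarrow> tangle_equiv m n y z \<Longrightarrow> tangle_equiv m n x z"
  unfolding tangle_equiv_def by (rule equivclp_trans)

lemma tangle_equiv_equivalent: "tangle_equiv 0 0 = equivalent"
proof -
  have "tangle_move 0 0 = diagram_move"
    by (intro ext) (auto simp: tangle_move.simps diagram_move.simps link_word_def)
  then show ?thesis by (simp add: tangle_equiv_def equivalent_def)
qed

lemma tangle_equiv_map: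
  assumes "tangle_equiv m n x y"
    and "\<And>x y. tangle_move m n x y \<Longrightarrow> tangle_move m' n' (f x) (f y)"
  shows "tangle_equiv m' n' (f x) (f y)"
  using assms(1) unfolding tangle_equiv_def
proof (induction rule: equivclp_induct)
  case (step y z)
  then show ?case using assms(2) by (meson equivclp_into_equivclp)
qed simp

lemma tangle_equiv_context:
  assumes "tangle_equiv m n x y" "tangle_word m' u m" "tangle_word n v n'"
  shows "tangle_equiv m' n' (u @ x @ v) (u @ y @ v)"
  using assms(1)
proof (rule tangle_equiv_map[where f = "\<lambda>x. u @ x @ v"])
  fix x y assume "tangle_move m n x y"
  then obtain l r u' v' where *: "isotopy_move l r \<or> reidemeister_move l r"
    "x = u' @ l @ v'" "y = u' @ r @ v'" "tangle_word m x n" "tangle_word m y n"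
    by (auto elim!: tangle_move.cases)
  then have "tangle_move m' n' ((u @ u') @ l @ (v' @ v)) ((u @ u') @ r @ (v' @ v))"
    using assms(2,3) by (intro tangle_move.intros) (fastforce simp: tangle_word_append)+
  with * show "tangle_move m' n' (u @ x @ v) (u @ y @ v)" by simp
qed

lemma isotopy_move_translate:
  "isotopy_move l r \<Longrightarrow> isotopy_move (translate k l) (translate k r)"
proof (induction rule: isotopy_move.induct)
  case (exchange i b j b')
  show ?case using isotopy_move.exchange[of "k + i" b j b'] by (simp add: add.assoc)
qed (use isotopy_move.intros[where i = "k + _"] in \<open>auto simp: add.assoc\<close>)

lemma reidemeister_move_translate:
  "reidemeister_move l r \<Longrightarrow> reidemeister_move (translate k l) (translate k r)"
proof (induction rule: reidemeister_move.induct)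
  case (R3 c\<^sub>2 c\<^sub>1 c\<^sub>3 i)
  then show ?case using reidemeister_move.R3[of c\<^sub>2 c\<^sub>1 c\<^sub>3 "k + i"] by (simp add: add.assoc)
qed (auto intro: reidemeister_move.intros)

lemma tangle_equiv_widen:
  assumes "tangle_equiv m n x y"
  shows "tangle_equiv (k + m + j) (k + n + j) (translate k x) (translate k y)"
  using assms
proof (rule tangle_equiv_map)
  fix x y assume "tangle_move m n x y"
  then obtain l r u v where *: "isotopy_move l r \<or> reidemeister_move l r"
    "x = u @ l @ v" "y = u @ r @ v" "tangle_word m x n" "tangle_word m y n"
    by (auto elim!: tangle_move.cases)
  have "tangle_move (k + m + j) (k + n + j) (translate k u @ translate k l @ translate k v)
      (translate k u @ translate k r @ translate k v)"
    using * tangle_word_widen[of m x n k j] tangle_word_widen[of m y n k j]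
    by (intro tangle_move.intros) (auto intro: isotopy_move_translate reidemeister_move_translate)
  with * show "tangle_move (k + m + j) (k + n + j) (translate k x) (translate k y)" by simp
qed

lemma tangle_equiv_move:
  assumes "isotopy_move l r \<or> reidemeister_move l r" "tangle_word m l n" "tangle_word m r n"
  shows "tangle_equiv m n l r"
  using assms tangle_move.intros[of l r m "[]" "[]" n]
  by (auto simp: tangle_equiv_def intro: r_into_equivclp)

text \<open>Form for chains of equivalences: the equations for \<open>X\<close> and \<open>Y\<close>
  are left to the simplifier, so only the context \<open>u\<close>, \<open>v\<close> has to be
  named.\<close>

lemma tangle_equiv_step:
  assumes "tangle_equiv m n x y" "X = u @ x @ v" "Y = u @ y @ v"
    and "tangle_word m' u m" "tangle_word n v n'"
  shows "tangle_equiv m' n' X Y"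
  using tangle_equiv_context[of m n x y m' u v n'] assms by simp

text \<open>The slices of \<open>T\<close> are exchanged with the distant feature one by one. The
  feature sits among \<open>j\<close> strands to the right of \<open>T\<close>, so its position is
  counted from the right edge of \<open>T\<close>, which is \<open>n\<close> below and
  \<open>m\<close> above.\<close>

lemma tangle_equiv_commute:
  assumes "tangle_word m T n" "k + ins b \<le> j"
  shows "tangle_equiv (m + j) (n + (j - ins b + outs b)) (T @ [(n + k, b)]) ((m + k, b) # T)"
  using assms
proof (induction m T n rule: tangle_word.induct)
  case (2 m i c T n)
  let ?m = "m - ins c + outs c" and ?j = "j - ins b + outs b"
  have le: "i + ins c \<le> m" and T: "tangle_word ?m T n" using 2 by auto
  have w: "tangle_word (m + j) [(i, c)] (?m + j)" using le by simp
  have "tangle_equiv (?m + j) (n + ?j) (T @ [(n + k, b)]) ((?m + k, b) # T)"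
    using 2(1)[OF T 2(3)] .
  then have "tangle_equiv (m + j) (n + ?j) (((i, c) # T) @ [(n + k, b)]) ((i, c) # (?m + k, b) # T)"
    by (rule tangle_equiv_step[where u = "[(i, c)]" and v = "[]"]) (use w in simp_all)
  also have "tangle_equiv (m + j) (n + ?j) \<dots> ((m + k, b) # (i, c) # T)"
  proof (rule tangle_equiv_step[where u = "[]" and v = T])
    \<comment> \<open>\<open>m - i - ins c\<close> strands of \<open>T\<close> and \<open>k\<close>
      further ones lie between the two features.\<close>
    have "isotopy_move [(i, c), (?m + k, b)] [(m + k, b), (i, c)]"
      using isotopy_move.exchange[of i c "m - i - ins c + k" b] le
      by (simp add: algebra_simps)
    then show "tangle_equiv (m + j) (?m + ?j) [(i, c), (?m + k, b)] [(m + k, b), (i, c)]"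
      using le 2 by (intro tangle_equiv_move) auto
    show "tangle_word (?m + ?j) T (n + ?j)" using T by (rule tangle_word_widen_right)
  qed simp_all
  finally show ?case .
qed simp


section \<open>Simplifying rational tangles\<close>

lemmas tangle_equiv_isotopy = tangle_equiv_move[OF disjI1]
lemmas tangle_equiv_reidemeister = tangle_equiv_move[OF disjI2]

lemma tangle_equiv_2_2_commute:
  assumes "tangle_word 2 T 2"
  shows "tangle_equiv 4 4 (T @ [(2, Cross c)]) ((2, Cross c) # T)"
    and "tangle_equiv 6 6 (T @ [(3, Cross c)]) ((3, Cross c) # T)"
    and "tangle_equiv 6 4 (T @ [(2, Cup)]) ((2, Cup) # T)"
    and "tangle_equiv 2 4 (T @ [(2, Cap)]) ((2, Cap) # T)"
  using tangle_equiv_commute[OF assms, of 0 "Cross c" 2] tangle_equiv_commute[OF assms, of 1 "Cross c" 4]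
    tangle_equiv_commute[OF assms, of 0 Cup 4] tangle_equiv_commute[OF assms, of 0 Cap 0]
  by (simp_all add: eval_nat_numeral)

lemma tangle_word_4_6:
  assumes "tangle_word 2 T 2"
  shows "tangle_word 2 T k \<longleftrightarrow> k = 2" "tangle_word 4 T k \<longleftrightarrow> k = 4" "tangle_word 6 T k \<longleftrightarrow> k = 6"
  using tangle_word_widen_right[OF assms, of 2] tangle_word_widen_right[OF assms, of 4]
    tangle_word_unique assms by auto

lemma slide_cap_12: "tangle_equiv 2 4 [(1, Cap), (2, Cross c)] [(2, Cap), (1, Cross (\<not> c))]"
  using isotopy_move.slide_cap[of 1 c]
  by (intro tangle_equiv_isotopy) (auto simp: eval_nat_numeral)

lemma slide_cup_12: "tangle_equiv 4 2 [(2, Cross c), (1, Cup)] [(1, Cross (\<not> c)), (2, Cup)]"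
  using isotopy_move.slide_cup[of 1 c]
  by (intro tangle_equiv_isotopy) (auto simp: eval_nat_numeral)

lemma exchange_cap_crossing:
  "tangle_equiv 4 6 [(1, Cap), (3, Cross c)] [(1, Cross c), (1, Cap)]"
  using isotopy_move.exchange[of 1 Cap 0 "Cross c"]
  by (intro tangle_equiv_isotopy) (auto simp: eval_nat_numeral)

lemma zigzags_12:
  "tangle_equiv 4 4 [(1, Cap), (2, Cup)] []" "tangle_equiv 2 2 [(2, Cap), (1, Cup)] []"
  using isotopy_move.zigzag_left[of 1] isotopy_move.zigzag_right[of 1]
  by (auto intro!: tangle_equiv_isotopy simp: eval_nat_numeral)

text \<open>The new crossing lies to the right of \<open>T\<close>, so it can rise past
  \<open>T\<close> and then go around the cap that bent NE down. The slide rotates it, which negates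
  the label.\<close>

lemma right_twist_slide_cap:
  assumes T: "tangle_word 2 T 2"
  shows "tangle_equiv 2 2 (right_twist c T) ([(2, Cap), (1, Cross (\<not> c))] @ T @ [(1, Cup)])"
proof -
  note [simp] = tangle_word_append tangle_word_4_6[OF T]
  have "tangle_equiv 2 2 (right_twist c T) ([(1, Cap), (2, Cross c)] @ T @ [(1, Cup)])"
    by (rule tangle_equiv_step[OF tangle_equiv_2_2_commute(1)[OF T],
          where u = "[(1, Cap)]" and v = "[(1, Cup)]"])
      (auto simp: right_twist_def)
  also have "tangle_equiv 2 2 \<dots> ([(2, Cap), (1, Cross (\<not> c))] @ T @ [(1, Cup)])"
    by (rule tangle_equiv_step[OF slide_cap_12, where u = "[]" and v = "T @ [(1, Cup)]"]) auto
  finally show ?thesis .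
qed

lemma right_twist_slide_cup:
  assumes T: "tangle_word 2 T 2"
  shows "tangle_equiv 2 2 (right_twist c T) ([(1, Cap)] @ T @ [(1, Cross (\<not> c)), (2, Cup)])"
  by (rule tangle_equiv_step[OF slide_cup_12, where u = "[(1, Cap)] @ T" and v = "[]"])
    (auto simp: right_twist_def tangle_word_append tangle_word_4_6[OF T])

text \<open>Slid to the left leg of the cap, the crossing sits directly on the cup: it is a kink for
  either label, and without it only a zigzag remains.\<close>

lemma right_twist_Nil: "tangle_equiv 2 2 (right_twist c []) []"
proof -
  have "tangle_equiv 2 2 (right_twist c []) [(2, Cap), (1, Cross (\<not> c)), (1, Cup)]"
    using right_twist_slide_cap[of "[]" c] by simp
  also have "tangle_equiv 2 2 \<dots> [(2, Cap), (1, Cup)]"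
    by (rule tangle_equiv_step[OF tangle_equiv_reidemeister[OF R1_cup[of 1 "\<not> c"], of 4 2],
          where u = "[(2, Cap)]" and v = "[]"]) auto
  also have "tangle_equiv 2 2 \<dots> []"
    by (rule zigzags_12(2))
  finally show ?thesis .
qed

lemma bottom_twist_cancel:
  assumes T: "tangle_word 2 T 2"
  shows "tangle_equiv 2 2 (bottom_twist (\<not> c) (bottom_twist c T)) T"
  by (rule tangle_equiv_step[OF tangle_equiv_reidemeister[OF R2[of 0 c], of 2 2],
        where u = T and v = "[]"]) (auto simp: bottom_twist_def T)

text \<open>The crossing moves from the left legs of two nested cups to their right legs. It is
  rotated twice, so its label returns; after the first slide the cups stand side by side and have to
  be exchanged before the second.\<close>

lemma nested_cups_slide:
  "tangle_equiv 6 2 [(1, Cross c), (2, Cup), (1, Cup)] [(3, Cross c), (2, Cup), (1, Cup)]"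
proof -
  have "tangle_equiv 6 2 [(1, Cross c), (2, Cup), (1, Cup)] [(2, Cross (\<not> c)), (1, Cup), (1, Cup)]"
    using isotopy_move.slide_cup[of 1 "\<not> c"]
    by (intro tangle_equiv_step[OF tangle_equiv_sym[OF tangle_equiv_isotopy[of
            "[(2, Cross (\<not> c)), (1, Cup)]" "[(1, Cross c), (2, Cup)]" 6 4]],
          where u = "[]" and v = "[(1, Cup)]"]) (auto simp: eval_nat_numeral)
  also have "tangle_equiv 6 2 \<dots> [(2, Cross (\<not> c)), (3, Cup), (1, Cup)]"
    using isotopy_move.exchange[of 1 Cup 0 Cup]
    by (intro tangle_equiv_step[OF tangle_equiv_isotopy[of "[(1, Cup), (1, Cup)]" "[(3, Cup), (1, Cup)]" 6 2],
          where u = "[(2, Cross (\<not> c))]" and v = "[]"]) (auto simp: eval_nat_numeral)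
  also have "tangle_equiv 6 2 \<dots> [(3, Cross c), (2, Cup), (1, Cup)]"
    using isotopy_move.slide_cup[of 2 c]
    by (intro tangle_equiv_step[OF tangle_equiv_sym[OF tangle_equiv_isotopy[of
            "[(3, Cross c), (2, Cup)]" "[(2, Cross (\<not> c)), (3, Cup)]" 6 4]],
          where u = "[]" and v = "[(1, Cup)]"]) (auto simp: eval_nat_numeral)
  finally show ?thesis .
qed

text \<open>The new crossing of the outer twist is slid to the top, that of the inner twist to the bottom,
  from where it returns to the top around the two nested cups.\<close>

lemma right_twist_cancel:
  assumes T: "tangle_word 2 T 2"
  shows "tangle_equiv 2 2 (right_twist (\<not> c) (right_twist c T)) T"
proof -
  note [simp] = tangle_word_append tangle_word_4_6[OF T]
  have "tangle_equiv 2 2 (right_twist (\<not> c) (right_twist c T))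
      ([(2, Cap), (1, Cross c)] @ right_twist c T @ [(1, Cup)])"
    using right_twist_slide_cap[of "right_twist c T" "\<not> c"] by (simp add: right_twist_def)
  also have "tangle_equiv 2 2 \<dots>
      ([(2, Cap), (1, Cross c), (1, Cap)] @ T @ [(1, Cross (\<not> c)), (2, Cup), (1, Cup)])"
    by (rule tangle_equiv_step[OF tangle_equiv_widen[OF right_twist_slide_cup[OF T], of 0 2],
          where u = "[(2, Cap), (1, Cross c)]" and v = "[(1, Cup)]"]) auto
  also have "tangle_equiv 2 2 \<dots>
      ([(2, Cap), (1, Cross c), (1, Cap)] @ T @ [(3, Cross (\<not> c)), (2, Cup), (1, Cup)])"
    by (rule tangle_equiv_step[OF nested_cups_slide,
          where u = "[(2, Cap), (1, Cross c), (1, Cap)] @ T" and v = "[]"]) auto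
  also have "tangle_equiv 2 2 \<dots>
      ([(2, Cap), (1, Cross c), (1, Cap), (3, Cross (\<not> c))] @ T @ [(2, Cup), (1, Cup)])"
    by (rule tangle_equiv_step[OF tangle_equiv_2_2_commute(2)[OF T],
          where u = "[(2, Cap), (1, Cross c), (1, Cap)]" and v = "[(2, Cup), (1, Cup)]"]) auto
  \<comment> \<open>Strands 3 and 4 below the cap are strands 1 and 2 above it, where the crossing
    meets the other one.\<close>
  also have "tangle_equiv 2 2 \<dots>
      ([(2, Cap), (1, Cross c), (1, Cross (\<not> c)), (1, Cap)] @ T @ [(2, Cup), (1, Cup)])"
    by (rule tangle_equiv_step[OF exchange_cap_crossing,
          where u = "[(2, Cap), (1, Cross c)]" and v = "T @ [(2, Cup), (1, Cup)]"]) auto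
  also have "tangle_equiv 2 2 \<dots> ([(2, Cap), (1, Cap)] @ T @ [(2, Cup), (1, Cup)])"
    by (rule tangle_equiv_step[OF tangle_equiv_reidemeister[OF R2[of 1 c], of 4 4],
          where u = "[(2, Cap)]" and v = "[(1, Cap)] @ T @ [(2, Cup), (1, Cup)]"]) auto
  \<comment> \<open>Two zigzags are left. One cup has to rise past \<open>T\<close> to meet its cap,
    and then one cap has to sink past \<open>T\<close> to meet its cup.\<close>
  also have "tangle_equiv 2 2 \<dots> ([(2, Cap), (1, Cap), (2, Cup)] @ T @ [(1, Cup)])"
    by (rule tangle_equiv_step[OF tangle_equiv_2_2_commute(3)[OF T],
          where u = "[(2, Cap), (1, Cap)]" and v = "[(1, Cup)]"]) auto
  also have "tangle_equiv 2 2 \<dots> ((2, Cap) # T @ [(1, Cup)])"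
    by (rule tangle_equiv_step[OF zigzags_12(1), where u = "[(2, Cap)]" and v = "T @ [(1, Cup)]"]) auto
  also have "tangle_equiv 2 2 \<dots> (T @ [(2, Cap), (1, Cup)])"
    by (rule tangle_equiv_step[OF tangle_equiv_sym[OF tangle_equiv_2_2_commute(4)[OF T]],
          where u = "[]" and v = "[(1, Cup)]"]) auto
  also have "tangle_equiv 2 2 \<dots> T"
    by (rule tangle_equiv_step[OF zigzags_12(2), where u = T and v = "[]"]) auto
  finally show ?thesis .
qed

section \<open>Lists of twists and splittable closures\<close>

lemma splittable_equivalent: "equivalent D D' \<Longrightarrow> splittable D' \<Longrightarrow> splittable D"
  unfolding splittable_def equivalent_def by (blast intro: equivclp_trans)

lemma splittable_two_circles: "splittable [(0, Cap), (0, Cup), (0, Cap), (0, Cup)]"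
proof -
  let ?w = "[(0, Cap), (0, Cup)] :: diagram"
  have "equivalent [(0, Cap), (0, Cup), (0, Cap), (0, Cup)] ([] @ translate 0 ?w @ ?w)"
    by (simp add: equivalent_def)
  then show ?thesis
    unfolding splittable_def
    by (rule_tac exI[of _ "[]"], rule_tac exI[of _ ?w], rule_tac exI[of _ ?w], rule_tac exI[of _ 0])
      (simp add: link_word_def)
qed

text \<open>One pair per crossing: the kind (\<open>True\<close> for the bottom ends) and the label.
  Play can give different labels within one syllable, which \<open>add_syllable\<close> cannot
  express.\<close>

definition twist :: "bool \<times> bool \<Rightarrow> diagram \<Rightarrow> diagram" where
  "twist = (\<lambda>(k, c). if k then bottom_twist c else right_twist c)"

definition twists :: "(bool \<times> bool) list \<Rightarrow> diagram" where
  "twists tw = fold twist tw []"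

lemma tangle_word_twist: "tangle_word 2 T 2 \<Longrightarrow> tangle_word 2 (twist x T) 2"
  by (auto simp: twist_def bottom_twist_def right_twist_def tangle_word_append tangle_word_4_6
      split: prod.splits)

lemma tangle_word_fold_twist: "tangle_word 2 T 2 \<Longrightarrow> tangle_word 2 (fold twist tw T) 2"
  by (induction tw arbitrary: T) (auto intro: tangle_word_twist)

lemma tangle_word_twists: "tangle_word 2 (twists tw) 2"
  by (simp add: twists_def tangle_word_fold_twist)

lemma tangle_equiv_twist:
  assumes "tangle_equiv 2 2 T T'"
  shows "tangle_equiv 2 2 (twist x T) (twist x T')"
proof (cases x)
  case (Pair k c)
  have "tangle_equiv 2 2 (bottom_twist c T) (bottom_twist c T')"
    by (rule tangle_equiv_step[OF assms, where u = "[]" and v = "[(0, Cross c)]"])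
      (auto simp: bottom_twist_def)
  moreover have "tangle_equiv 4 4 T T'"
    using tangle_equiv_widen[OF assms, of 0 2] by (simp add: eval_nat_numeral)
  then have "tangle_equiv 2 2 (right_twist c T) (right_twist c T')"
    by (rule tangle_equiv_step[where u = "[(1, Cap)]" and v = "[(2, Cross c), (1, Cup)]"])
      (auto simp: right_twist_def)
  ultimately show ?thesis by (simp add: twist_def Pair)
qed

lemma tangle_equiv_fold_twist:
  "tangle_equiv 2 2 T T' \<Longrightarrow> tangle_equiv 2 2 (fold twist tw T) (fold twist tw T')"
  by (induction tw arbitrary: T T') (auto intro: tangle_equiv_twist)

lemma twist_cancel:
  "tangle_word 2 T 2 \<Longrightarrow> tangle_equiv 2 2 (twist (k, \<not> c) (twist (k, c) T)) T"
  by (simp add: twist_def bottom_twist_cancel right_twist_cancel)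

definition doubled :: "(bool \<times> bool \<times> bool) list \<Rightarrow> (bool \<times> bool) list" where
  "doubled ps = concat (map (\<lambda>(k, c, c'). [(k, c), (k, c')]) ps)"

lemma doubled_simps [simp]:
  "doubled [] = []"
  "doubled ((k, c, c') # ps) = (k, c) # (k, c') # doubled ps"
  "doubled (ps @ ps') = doubled ps @ doubled ps'"
  by (simp_all add: doubled_def)

text \<open>The induction hypothesis removes the outer pairs first, for the twisted tangle in place
  of \<open>T\<close>; then the innermost pair cancels directly.\<close>

lemma fold_twist_doubled:
  "tangle_word 2 T 2 \<Longrightarrow> \<forall>(k, c, c') \<in> set ps. c' = (\<not> c) \<Longrightarrow>
    tangle_equiv 2 2 (fold twist (doubled ps) T) T"
proof (induction ps arbitrary: T)
  case (Cons x ps)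
  obtain k c where x: "x = (k, c, \<not> c)" using Cons(3) by (cases x) auto
  have "tangle_equiv 2 2 (fold twist (doubled ps) (twist (k, \<not> c) (twist (k, c) T)))
      (twist (k, \<not> c) (twist (k, c) T))"
    using Cons by (auto intro!: Cons(1) tangle_word_twist)
  also have "tangle_equiv 2 2 \<dots> T" using Cons by (intro twist_cancel)
  finally show ?case by (simp add: x)
qed simp

text \<open>The innermost twist acts on the empty tangle and is a kink for either label. Undoing it
  exposes the next one to the same argument.\<close>

lemma twists_right:
  "\<forall>x\<in>set tw. \<not> fst x \<Longrightarrow> tangle_equiv 2 2 (twists tw) []"
proof (induction tw)
  case (Cons x tw)
  obtain c where x: "x = (False, c)" using Cons(2) by (cases x) auto
  have "tangle_equiv 2 2 (twists (x # tw)) (twists tw)"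
    unfolding twists_def using right_twist_Nil[of c] tangle_equiv_fold_twist
    by (simp add: x twist_def)
  also have "tangle_equiv 2 2 \<dots> []" using Cons by simp
  finally show ?case .
qed (simp add: twists_def)

lemma splittable_denominator_closure:
  assumes "tangle_equiv 2 2 T []"
  shows "splittable (denominator_closure T)"
proof -
  have "tangle_equiv 4 4 (translate 1 T) []"
    using tangle_equiv_widen[OF assms, of 1 1] by (simp add: eval_nat_numeral)
  then have "tangle_equiv 0 0 (denominator_closure T) [(0, Cap), (2, Cap), (0, Cup), (0, Cup)]"
    by (rule tangle_equiv_step[where u = "[(0, Cap), (2, Cap)]" and v = "[(0, Cup), (0, Cup)]"])
      (auto simp: denominator_closure_def)
  also have "tangle_equiv 0 0 \<dots> [(0, Cap), (0, Cup), (0, Cap), (0, Cup)]"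
    using isotopy_move.exchange[of 0 Cup 0 Cap]
    by (intro tangle_equiv_step[OF tangle_equiv_sym[OF tangle_equiv_isotopy[of
            "[(0, Cup), (0, Cap)]" "[(2, Cap), (0, Cup)]" 2 2]],
          where u = "[(0, Cap)]" and v = "[(0, Cup)]"]) (auto simp: numeral_2_eq_2)
  finally show ?thesis
    using splittable_equivalent splittable_two_circles by (simp add: tangle_equiv_equivalent)
qed

text \<open>The bottom crossing slides around the outer cap and the right crossing around the inner
  cup, both onto strands 1 and 2. Each slide negates a label, so opposite labels stay opposite and
  the second Reidemeister move applies.\<close>

lemma splittable_numerator_closure:
  assumes "tangle_equiv 2 2 T (twists [(True, c), (False, \<not> c)])"
  shows "splittable (numerator_closure T)"
proof -
  have "tangle_equiv 0 0 (numerator_closure T)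
      [(0, Cap), (1, Cap), (0, Cross c), (2, Cross (\<not> c)), (1, Cup), (0, Cup)]"
    by (rule tangle_equiv_step[OF assms, where u = "[(0, Cap)]" and v = "[(0, Cup)]"])
      (auto simp: numerator_closure_def twists_def twist_def bottom_twist_def right_twist_def)
  also have "tangle_equiv 0 0 \<dots>
      [(0, Cap), (0, Cap), (1, Cross (\<not> c)), (2, Cross (\<not> c)), (1, Cup), (0, Cup)]"
    using isotopy_move.slide_cap[of 0 "\<not> c"]
    by (intro tangle_equiv_step[OF tangle_equiv_sym[OF tangle_equiv_isotopy[of
            "[(0, Cap), (1, Cross (\<not> c))]" "[(1, Cap), (0, Cross c)]" 2 4]],
          where u = "[(0, Cap)]" and v = "[(2, Cross (\<not> c)), (1, Cup), (0, Cup)]"]) auto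
  also have "tangle_equiv 0 0 \<dots>
      [(0, Cap), (0, Cap), (1, Cross (\<not> c)), (1, Cross c), (2, Cup), (0, Cup)]"
    by (rule tangle_equiv_step[OF slide_cup_12[of "\<not> c"],
          where u = "[(0, Cap), (0, Cap), (1, Cross (\<not> c))]" and v = "[(0, Cup)]"]) auto
  also have "tangle_equiv 0 0 \<dots> [(0, Cap), (0, Cap), (2, Cup), (0, Cup)]"
    using reidemeister_move.R2[of 1 "\<not> c"]
    by (intro tangle_equiv_step[OF tangle_equiv_reidemeister[of
            "[(1, Cross (\<not> c)), (1, Cross c)]" "[]" 4 4],
          where u = "[(0, Cap), (0, Cap)]" and v = "[(2, Cup), (0, Cup)]"]) auto
  also have "tangle_equiv 0 0 \<dots> [(0, Cap), (0, Cup), (0, Cap), (0, Cup)]"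
    using isotopy_move.exchange[of 0 Cap 0 Cup]
    by (intro tangle_equiv_step[OF tangle_equiv_isotopy[of
            "[(0, Cap), (2, Cup)]" "[(0, Cup), (0, Cap)]" 2 2],
          where u = "[(0, Cap)]" and v = "[(0, Cup)]"]) (auto simp: numeral_2_eq_2)
  finally show ?thesis
    using splittable_equivalent splittable_two_circles by (simp add: tangle_equiv_equivalent)
qed

lemma twists_doubled:
  "\<forall>(k, c, c') \<in> set ps. c' = (\<not> c) \<Longrightarrow> tangle_equiv 2 2 (twists (doubled ps)) []"
  by (simp add: twists_def fold_twist_doubled)

text \<open>The first twist serves as the tangle on which the pairs cancel; the last twist is then
  applied by congruence.\<close>

lemma twists_enclosed_doubled:
  assumes "\<forall>(k, c, c') \<in> set ps. c' = (\<not> c)"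
  shows "tangle_equiv 2 2 (twists ((k, c) # doubled ps @ [(k', c')])) (twists [(k, c), (k', c')])"
proof -
  have "tangle_word 2 (twist (k, c) []) 2" by (rule tangle_word_twist) simp
  from tangle_equiv_twist[OF fold_twist_doubled[OF this assms], of "(k', c')"] show ?thesis
    by (simp add: twists_def)
qed

section \<open>Colourings and the linking number modulo 2\<close>

text \<open>A relation, because the colour of a cap is free. The strand of positive slope runs from
  upper right to lower left and so carries \<open>b\<close>; this is the overstrand if
  \<open>c\<close> holds.\<close>

fun colour_brick :: "bool brick \<Rightarrow> bool list \<Rightarrow> bool list \<Rightarrow> bool \<Rightarrow> bool" where
  "colour_brick Cap p q v \<longleftrightarrow> (\<exists>a. p = [] \<and> q = [a, a] \<and> \<not> v)"
| "colour_brick Cup p q v \<longleftrightarrow> (\<exists>a. p = [a, a] \<and> q = [] \<and> \<not> v)"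
| "colour_brick (Cross c) p q v \<longleftrightarrow>
    (\<exists>a b. p = [a, b] \<and> q = [b, a] \<and> v = (if c then b \<and> \<not> a else a \<and> \<not> b))"

fun colour_slice :: "nat \<times> bool brick \<Rightarrow> bool list \<Rightarrow> bool list \<Rightarrow> bool \<Rightarrow> bool" where
  "colour_slice (i, b) s t v \<longleftrightarrow> (\<exists>xs p q ys. length xs = i \<and> s = xs @ p @ ys \<and> t = xs @ q @ ys
     \<and> colour_brick b p q v)"

text \<open>
  \<open>colouring w s t v U\<close>: the strands of \<open>w\<close> can be coloured by Booleans, with colours \<open>s\<close> at the top,
  \<open>t\<close> at the bottom and \<open>U\<close> the set of all colours used, such that \<open>v\<close> is the parity of the number
  of crossings at which a \<open>True\<close> strand passes over a \<open>False\<close> one. If each component of a link has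
  one colour, this is the linking number modulo 2 of the two colour classes.
\<close>

fun colouring :: "diagram \<Rightarrow> bool list \<Rightarrow> bool list \<Rightarrow> bool \<Rightarrow> bool set \<Rightarrow> bool" where
  "colouring [] s t v U \<longleftrightarrow> t = s \<and> \<not> v \<and> U = set s"
| "colouring (x # w) s t v U \<longleftrightarrow> (\<exists>s' v\<^sub>1 v\<^sub>2 U'. colour_slice x s s' v\<^sub>1 \<and> colouring w s' t v\<^sub>2 U'
     \<and> v = (v\<^sub>1 \<noteq> v\<^sub>2) \<and> U = set s \<union> U')"

declare colour_slice.simps [simp del]

lemma colour_brick_length: "colour_brick b p q v \<Longrightarrow> length p = ins b \<and> length q = outs b"
  by (cases b) auto

lemma colour_slice_shift:
  assumes "length xs = k"
  shows "colour_slice (k + i, b) (xs @ s) t v \<longleftrightarrow> (\<exists>t'. t = xs @ t' \<and> colour_slice (i, b) s t' v)"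
    (is "?l \<longleftrightarrow> ?r")
proof
  assume ?l
  then obtain zs p q ys where *: "length zs = k + i" "xs @ s = zs @ p @ ys" "t = zs @ q @ ys"
    "colour_brick b p q v" by (auto simp: colour_slice.simps)
  then obtain zs' where "zs = xs @ zs'"
    using assms by (auto simp: append_eq_append_conv2)
  with * assms show ?r
    by (auto simp: colour_slice.simps)
next
  assume ?r
  then obtain t' where t': "t = xs @ t'" "colour_slice (i, b) s t' v" by auto
  then obtain zs p q ys where "length zs = i" "s = zs @ p @ ys" "t' = zs @ q @ ys"
    "colour_brick b p q v" by (auto simp: colour_slice.simps)
  then show ?l using assms t'(1)
    unfolding colour_slice.simps
    by (intro exI[of _ "xs @ zs"] exI[of _ p] exI[of _ q] exI[of _ ys]) auto
qed

lemma colour_slice_append: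
  assumes "i + ins b \<le> length s"
  shows "colour_slice (i, b) (s @ ys) t v \<longleftrightarrow> (\<exists>t'. t = t' @ ys \<and> colour_slice (i, b) s t' v)"
    (is "?l \<longleftrightarrow> ?r")
proof
  assume ?l
  then obtain xs p q zs where *: "length xs = i" "s @ ys = (xs @ p) @ zs" "t = xs @ q @ zs"
    "colour_brick b p q v" by (auto simp: colour_slice.simps)
  define zs' where "zs' = drop (length (xs @ p)) s"
  have "length (xs @ p) \<le> length s" using assms *(1) colour_brick_length[OF *(4)] by simp
  then have "s = xs @ p @ zs'" "zs = zs' @ ys"
    using arg_cong[OF *(2), of "take (length (xs @ p))"] arg_cong[OF *(2), of "drop (length (xs @ p))"]
      append_take_drop_id[of "length (xs @ p)" s]
    by (simp_all add: zs'_def del: append_take_drop_id)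
  with * show ?r unfolding colour_slice.simps
    by (intro exI[of _ "xs @ q @ zs'"]) auto
next
  assume ?r
  then obtain t' xs p q zs where *: "t = t' @ ys" "length xs = i" "s = xs @ p @ zs" "t' = xs @ q @ zs"
    "colour_brick b p q v" unfolding colour_slice.simps by blast
  show ?l unfolding colour_slice.simps
    by (rule exI[of _ xs], rule exI[of _ p], rule exI[of _ q], rule exI[of _ "zs @ ys"]) (use * in simp)
qed

lemma colour_slice_Suc [simp]:
  "colour_slice (Suc i, b) (a # s) t v \<longleftrightarrow> (\<exists>t'. t = a # t' \<and> colour_slice (i, b) s t' v)"
  "\<not> colour_slice (Suc i, b) [] t v"
  using colour_slice_shift[of "[a]" 1 i b s t v] by (simp_all add: colour_slice.simps)

lemma colour_slice_0:
  "colour_slice (0, b) s t v \<longleftrightarrow> (\<exists>p q ys. s = p @ ys \<and> t = q @ ys \<and> colour_brick b p q v)"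
  by (simp add: colour_slice.simps)

lemma colour_slice_Cap [simp]: "colour_slice (0, Cap) s t v \<longleftrightarrow> (\<exists>a. t = a # a # s \<and> \<not> v)"
    (is "?l \<longleftrightarrow> ?r")
proof
  assume ?r
  then obtain a where "s = [] @ s" "t = [a, a] @ s" "colour_brick Cap [] [a, a] v" by auto
  then show ?l unfolding colour_slice_0 by blast
qed (auto simp: colour_slice_0)

lemma colour_slice_Cup [simp]: "colour_slice (0, Cup) s t v \<longleftrightarrow> (\<exists>a. s = a # a # t \<and> \<not> v)"
    (is "?l \<longleftrightarrow> ?r")
proof
  assume ?r
  then obtain a where "s = [a, a] @ t" "t = [] @ t" "colour_brick Cup [a, a] [] v" by auto
  then show ?l unfolding colour_slice_0 by blast
qed (auto simp: colour_slice_0)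

lemma colour_slice_Cross [simp]:
  "colour_slice (0, Cross c) s t v \<longleftrightarrow>
    (\<exists>a b r. s = a # b # r \<and> t = b # a # r \<and> v = (if c then b \<and> \<not> a else a \<and> \<not> b))"
    (is "?l \<longleftrightarrow> ?r")
proof
  assume ?r
  then obtain a b r where "s = [a, b] @ r" "t = [b, a] @ r" "colour_brick (Cross c) [a, b] [b, a] v"
    by auto
  then show ?l unfolding colour_slice_0 by blast
next
  assume ?l
  then obtain p q r where *: "s = p @ r" "t = q @ r" "colour_brick (Cross c) p q v"
    unfolding colour_slice_0 by blast
  from *(3) obtain a b where "p = [a, b]" "q = [b, a]" "v = (if c then b \<and> \<not> a else a \<and> \<not> b)"
    unfolding colour_brick.simps by blast
  with * show ?r by simp
qed

lemma colour_slice_length: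
  "colour_slice (i, b) s t v \<Longrightarrow> i + ins b \<le> length s \<and> length t = length s - ins b + outs b"
  unfolding colour_slice.simps by (auto dest!: colour_brick_length)

lemma colouring_append:
  "colouring (x @ y) s t v U \<longleftrightarrow> (\<exists>r v\<^sub>1 v\<^sub>2 U\<^sub>1 U\<^sub>2. colouring x s r v\<^sub>1 U\<^sub>1 \<and> colouring y r t v\<^sub>2 U\<^sub>2
    \<and> v = (v\<^sub>1 \<noteq> v\<^sub>2) \<and> U = U\<^sub>1 \<union> U\<^sub>2)" (is "?l x s v U \<longleftrightarrow> ?r x s v U")
proof (induction x arbitrary: s v U)
  case Nil
  \<comment> \<open>The line where the two words meet counts for both of them, which a union
    absorbs.\<close>
  have "set s \<union> U = U" if "colouring y s t v U" for v U
    using that by (cases y) auto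
  then show ?case by (simp cong: conj_cong) blast
next
  case (Cons a x)
  show ?case
  proof
    assume "?l (a # x) s v U"
    then obtain s' v\<^sub>1 v\<^sub>2 U' where 1: "colour_slice a s s' v\<^sub>1" "?l x s' v\<^sub>2 U'"
      "v = (v\<^sub>1 \<noteq> v\<^sub>2)" "U = set s \<union> U'" by auto
    from 1(2) obtain r v\<^sub>3 v\<^sub>4 U\<^sub>1 U\<^sub>2 where 2: "colouring x s' r v\<^sub>3 U\<^sub>1" "colouring y r t v\<^sub>4 U\<^sub>2"
      "v\<^sub>2 = (v\<^sub>3 \<noteq> v\<^sub>4)" "U' = U\<^sub>1 \<union> U\<^sub>2" unfolding Cons by blast
    have "colouring (a # x) s r (v\<^sub>1 \<noteq> v\<^sub>3) (set s \<union> U\<^sub>1)"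
      using 1(1) 2(1) unfolding colouring.simps by blast
    then show "?r (a # x) s v U" using 1 2 by blast
  next
    assume "?r (a # x) s v U"
    then obtain r v\<^sub>1 v\<^sub>2 U\<^sub>1 U\<^sub>2 where 1: "colouring (a # x) s r v\<^sub>1 U\<^sub>1" "colouring y r t v\<^sub>2 U\<^sub>2"
      "v = (v\<^sub>1 \<noteq> v\<^sub>2)" "U = U\<^sub>1 \<union> U\<^sub>2" by blast
    from 1(1) obtain s' v\<^sub>3 v\<^sub>4 U' where 2: "colour_slice a s s' v\<^sub>3" "colouring x s' r v\<^sub>4 U'"
      "v\<^sub>1 = (v\<^sub>3 \<noteq> v\<^sub>4)" "U\<^sub>1 = set s \<union> U'" unfolding colouring.simps by blast
    have "?l x s' (v\<^sub>4 \<noteq> v\<^sub>2) (U' \<union> U\<^sub>2)" unfolding Cons using 1(2) 2(2) by blast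
    with 2(1) have "?l (a # x) s (v\<^sub>3 \<noteq> (v\<^sub>4 \<noteq> v\<^sub>2)) (set s \<union> (U' \<union> U\<^sub>2))"
      unfolding colouring.simps append_Cons by blast
    moreover have "v = (v\<^sub>3 \<noteq> (v\<^sub>4 \<noteq> v\<^sub>2))" "U = set s \<union> (U' \<union> U\<^sub>2)"
      using 1(3,4) 2(3,4) by auto
    ultimately show "?l (a # x) s v U" by simp
  qed
qed

lemma colouring_length: "colouring w s t v U \<Longrightarrow> tangle_word (length s) w (length t)"
proof (induction w arbitrary: s v U)
  case (Cons x w)
  obtain i b where x: "x = (i, b)" by (cases x)
  from Cons(2) obtain s' v\<^sub>1 v\<^sub>2 U' where "colour_slice x s s' v\<^sub>1" "colouring w s' t v\<^sub>2 U'" by auto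
  then show ?case using Cons(1)[of s'] colour_slice_length[of i b s s' v\<^sub>1] by (simp add: x)
qed auto

lemma colouring_widen:
  assumes "tangle_word (length s) w n" "length xs = k"
  shows "colouring (translate k w) (xs @ s @ ys) t v U \<longleftrightarrow>
    (\<exists>t' U'. t = xs @ t' @ ys \<and> colouring w s t' v U' \<and> U = set xs \<union> set ys \<union> U')"
  using assms(1)
proof (induction w arbitrary: s v U)
  case (Cons x w)
  obtain i b where x: "x = (i, b)" by (cases x)
  have le: "i + ins b \<le> length s" using Cons(2) x by simp
  have slice: "colour_slice (k + i, b) (xs @ s @ ys) t' v' \<longleftrightarrow>
      (\<exists>s'. t' = xs @ s' @ ys \<and> colour_slice (i, b) s s' v')" for t' v'
    using le assms(2) by (auto simp: colour_slice_shift colour_slice_append)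
  have IH: "colouring (translate k w) (xs @ s' @ ys) t v' U' \<longleftrightarrow>
    (\<exists>t' V. t = xs @ t' @ ys \<and> colouring w s' t' v' V \<and> U' = set xs \<union> set ys \<union> V)"
    if "colour_slice (i, b) s s' v''" for s' v' v'' U'
    using Cons colour_slice_length[OF that] x by auto
  show ?case (is "?l \<longleftrightarrow> ?r")
  proof
    assume ?l
    then obtain s' v\<^sub>1 v\<^sub>2 U' where *: "colour_slice (i, b) s s' v\<^sub>1" "v = (v\<^sub>1 \<noteq> v\<^sub>2)"
      "colouring (translate k w) (xs @ s' @ ys) t v\<^sub>2 U'" "U = set (xs @ s @ ys) \<union> U'"
      unfolding x translate_simps colouring.simps slice by blast
    with IH obtain t' V where "t = xs @ t' @ ys" "colouring w s' t' v\<^sub>2 V" "U' = set xs \<union> set ys \<union> V"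
      by blast
    with * show ?r by (intro exI[of _ t'] exI[of _ "set s \<union> V"]) (auto simp: x)
  next
    assume ?r
    then obtain t' s' v\<^sub>1 v\<^sub>2 V where *: "t = xs @ t' @ ys" "colour_slice (i, b) s s' v\<^sub>1"
      "colouring w s' t' v\<^sub>2 V" "v = (v\<^sub>1 \<noteq> v\<^sub>2)" "U = set xs \<union> set ys \<union> (set s \<union> V)"
      unfolding x colouring.simps by blast
    then have "colouring (translate k w) (xs @ s' @ ys) t v\<^sub>2 (set xs \<union> set ys \<union> V)"
      using IH by blast
    then have "colouring (translate k (x # w)) (xs @ s @ ys) t (v\<^sub>1 \<noteq> v\<^sub>2)
        (set (xs @ s @ ys) \<union> (set xs \<union> set ys \<union> V))"
      unfolding x translate_simps colouring.simps slice using *(2) by blast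
    moreover have "set (xs @ s @ ys) \<union> (set xs \<union> set ys \<union> V) = U"
      using *(5) by auto
    ultimately show ?l using *(4) by simp
  qed
qed auto

text \<open>This reduces a local move at any position to a check on just the strands that it
  touches.\<close>

lemma colouring_translate_cong:
  assumes "\<And>s t v U. length s = m \<Longrightarrow> colouring l s t v U \<longleftrightarrow> colouring r s t v U"
    and "tangle_word m l n" "tangle_word m r n" "k + m \<le> length s"
  shows "colouring (translate k l) s t v U \<longleftrightarrow> colouring (translate k r) s t v U"
proof -
  define xs x ys where "xs = take k s" and "x = take m (drop k s)" and "ys = drop m (drop k s)"
  have s: "s = xs @ x @ ys" by (simp add: xs_def x_def ys_def del: drop_drop)
  have len: "length xs = k" "length x = m" using assms(4) by (auto simp: xs_def x_def)
  show ?thesis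
    unfolding s using assms(1)[OF len(2)] assms(2,3) len by (simp add: colouring_widen)
qed

lemma colouring_two_slices:
  "colouring [x, y] s t v U \<longleftrightarrow> (\<exists>r v\<^sub>1 v\<^sub>2. colour_slice x s r v\<^sub>1 \<and> colour_slice y r t v\<^sub>2
    \<and> v = (v\<^sub>1 \<noteq> v\<^sub>2) \<and> U = set s \<union> set r \<union> set t)"
  by (simp add: Un_assoc) blast

text \<open>The two features act on disjoint parts of the line. The lines between them differ in the
  two orders, but each of their colours also occurs on the top or the bottom line, so
  \<open>U\<close> agrees.\<close>

lemma colouring_exchange:
  assumes len: "i + ins b + k + ins b' \<le> length s"
  shows "colouring [(i, b), (i + outs b + k, b')] s t v U \<longleftrightarrow>
    colouring [(i + ins b + k, b'), (i, b)] s t v U" (is "?l \<longleftrightarrow> ?r")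
proof
  assume ?l
  then obtain r v\<^sub>1 v\<^sub>2 where *: "colour_slice (i, b) s r v\<^sub>1" "colour_slice (i + outs b + k, b') r t v\<^sub>2"
    "v = (v\<^sub>1 \<noteq> v\<^sub>2)" "U = set s \<union> set r \<union> set t"
    unfolding colouring_two_slices by blast
  from *(1) obtain xs p q ys where 1: "length xs = i" "s = (xs @ p) @ ys" "r = (xs @ q) @ ys"
    "colour_brick b p q v\<^sub>1" unfolding colour_slice.simps by auto
  note pq = colour_brick_length[OF 1(4)]
  with *(2) 1 obtain t' where 2: "t = (xs @ q) @ t'" "colour_slice (k, b') ys t' v\<^sub>2"
    using colour_slice_shift[of "xs @ q" "i + outs b"] by auto
  have "colour_slice (i + ins b + k, b') s ((xs @ p) @ t') v\<^sub>2"
    using colour_slice_shift[of "xs @ p" "i + ins b"] 1 2 pq by auto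
  moreover have "colour_slice (i, b) ((xs @ p) @ t') t v\<^sub>1"
    unfolding colour_slice.simps using 1 2 by (metis append.assoc)
  moreover have "v = (v\<^sub>2 \<noteq> v\<^sub>1)" "U = set s \<union> set ((xs @ p) @ t') \<union> set t"
    using *(3,4) 1 2 by auto
  ultimately show ?r unfolding colouring_two_slices by blast
next
  assume ?r
  then obtain r v\<^sub>1 v\<^sub>2 where *: "colour_slice (i + ins b + k, b') s r v\<^sub>2" "colour_slice (i, b) r t v\<^sub>1"
    "v = (v\<^sub>2 \<noteq> v\<^sub>1)" "U = set s \<union> set r \<union> set t"
    unfolding colouring_two_slices by blast
  define x ys where "x = take (i + ins b) s" and "ys = drop (i + ins b) s"
  have x: "s = x @ ys" "length x = i + ins b" using len by (auto simp: x_def ys_def)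
  with *(1) obtain t' where 1: "r = x @ t'" "colour_slice (k, b') ys t' v\<^sub>2"
    using colour_slice_shift[of x "i + ins b"] by auto
  have "i + ins b \<le> length x" using x by simp
  then obtain q where 2: "t = q @ t'" "colour_slice (i, b) x q v\<^sub>1"
    using *(2) colour_slice_append[of i b x t' t] 1(1) by auto
  have q: "length q = i + outs b" using colour_slice_length[OF 2(2)] x by auto
  have "colour_slice (i, b) s (q @ ys) v\<^sub>1"
    using colour_slice_append[of i b x ys] x 2 by auto
  moreover have "colour_slice (i + outs b + k, b') (q @ ys) t v\<^sub>2"
    using colour_slice_shift[OF q] 1 2 by auto
  moreover have "set q \<subseteq> set t" "set x \<subseteq> set s" using x 2 by auto
  moreover have "v = (v\<^sub>1 \<noteq> v\<^sub>2)" "U = set s \<union> set (q @ ys) \<union> set t"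
    using *(3,4) 1 2 x by auto
  ultimately show ?l unfolding colouring_two_slices by blast
qed

text \<open>The exclusive or is solved for the parity of the rest, which makes the slices usable as
  rewrite rules on explicit lists of colours.\<close>

lemma colouring_Cons:
  "colouring (x # w) s t v U \<longleftrightarrow>
    (\<exists>s' v'. colour_slice x s s' v' \<and> (\<exists>U'. colouring w s' t (v \<noteq> v') U' \<and> U = set s \<union> U'))"
    (is "?l \<longleftrightarrow> ?r")
proof
  assume ?l
  then obtain s' v\<^sub>1 v\<^sub>2 U' where *: "colour_slice x s s' v\<^sub>1" "colouring w s' t v\<^sub>2 U'"
    "v = (v\<^sub>1 \<noteq> v\<^sub>2)" "U = set s \<union> U'" unfolding colouring.simps by blast
  then have "v\<^sub>2 = (v \<noteq> v\<^sub>1)" by (cases v\<^sub>1; cases v\<^sub>2) simp_all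
  with *(2) have "colouring w s' t (v \<noteq> v\<^sub>1) U'" by (simp only:)
  with *(1,4) show ?r by (intro exI conjI)
next
  assume ?r
  then obtain s' v\<^sub>1 U' where "colour_slice x s s' v\<^sub>1" "colouring w s' t (v \<noteq> v\<^sub>1) U'"
    "U = set s \<union> U'" by blast
  moreover have "v = (v\<^sub>1 \<noteq> (v \<noteq> v\<^sub>1))" by (cases v; cases v\<^sub>1) simp_all
  ultimately show ?l unfolding colouring.simps by (intro exI conjI)
qed

lemma colouring_0:
  "colouring ((0, Cap) # w) s t v U \<longleftrightarrow>
    (\<exists>a U'. colouring w (a # a # s) t v U' \<and> U = set s \<union> U')"
  "colouring ((0, Cup) # w) (a # b # s) t v U \<longleftrightarrow>
    a = b \<and> (\<exists>U'. colouring w s t v U' \<and> U = set (a # b # s) \<union> U')"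
  "colouring ((0, Cross c) # w) (a # b # s) t v U \<longleftrightarrow>
    (\<exists>U'. colouring w (b # a # s) t (v \<noteq> (if c then b \<and> \<not> a else a \<and> \<not> b)) U'
      \<and> U = set (a # b # s) \<union> U')"
  unfolding colouring_Cons colour_slice_Cap colour_slice_Cup colour_slice_Cross by (safe; fastforce)+

lemma colouring_1:
  "colouring ((Suc 0, Cap) # w) (x # s) t v U \<longleftrightarrow>
    (\<exists>a U'. colouring w (x # a # a # s) t v U' \<and> U = set (x # s) \<union> U')"
  "colouring ((Suc 0, Cup) # w) (x # a # b # s) t v U \<longleftrightarrow>
    a = b \<and> (\<exists>U'. colouring w (x # s) t v U' \<and> U = set (x # a # b # s) \<union> U')"
  "colouring ((Suc 0, Cross c) # w) (x # a # b # s) t v U \<longleftrightarrow>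
    (\<exists>U'. colouring w (x # b # a # s) t (v \<noteq> (if c then b \<and> \<not> a else a \<and> \<not> b)) U'
      \<and> U = set (x # a # b # s) \<union> U')"
  unfolding colouring_Cons colour_slice_Suc colour_slice_Cap colour_slice_Cup colour_slice_Cross
  by (safe; fastforce)+

context
  notes colouring.simps(2) [simp del] and colouring_0 [simp] and colouring_1 [simp]
begin

lemma colouring_zigzag:
  "colouring [(0, Cap), (Suc 0, Cup)] [x] t v U \<longleftrightarrow> colouring [] [x] t v U"
  "colouring [(Suc 0, Cap), (0, Cup)] [x] t v U \<longleftrightarrow> colouring [] [x] t v U"
  by auto

lemma colouring_slide_cap:
  "colouring [(0, Cap), (Suc 0, Cross c)] [x] t v U \<longleftrightarrow>
    colouring [(Suc 0, Cap), (0, Cross (\<not> c))] [x] t v U"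
  by (cases x; cases c) (auto simp: ex_bool_eq)

lemma colouring_slide_cup:
  "colouring [(Suc 0, Cross c), (0, Cup)] [x, y, z] t v U \<longleftrightarrow>
    colouring [(0, Cross (\<not> c)), (Suc 0, Cup)] [x, y, z] t v U"
  by (cases x; cases y; cases z; cases c) auto

lemma colouring_R1:
  "colouring [(0, Cap), (0, Cross c)] [] t v U \<longleftrightarrow> colouring [(0, Cap)] [] t v U"
  "colouring [(0, Cross c), (0, Cup)] [x, y] t v U \<longleftrightarrow> colouring [(0, Cup)] [x, y] t v U"
  by (cases c; auto)+

text \<open>Opposite labels leave the same strand on top at both crossings, so the contributions are
  equal and cancel modulo 2.\<close>

lemma colouring_R2:
  "colouring [(0, Cross c), (0, Cross (\<not> c))] [x, y] t v U \<longleftrightarrow> colouring [] [x, y] t v U"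
  by (cases x; cases y; cases c) auto

text \<open>Each pair of strands crosses once on either side and with the same label, so the three
  contributions are merely reordered.\<close>

lemma colouring_R3:
  "colouring [(0, Cross c\<^sub>1), (Suc 0, Cross c\<^sub>2), (0, Cross c\<^sub>3)] [x, y, z] t v U \<longleftrightarrow>
    colouring [(Suc 0, Cross c\<^sub>3), (0, Cross c\<^sub>2), (Suc 0, Cross c\<^sub>1)] [x, y, z] t v U"
  by (cases x; cases y; cases z; cases c\<^sub>1; cases c\<^sub>2; cases c\<^sub>3) auto

end

section \<open>Invariance of colourings under moves\<close>

lemma length_1_2_3:
  "length s = Suc 0 \<Longrightarrow> \<exists>x. s = [x]" "length s = 2 \<Longrightarrow> \<exists>x y. s = [x, y]"
  "length s = 3 \<Longrightarrow> \<exists>x y z. s = [x, y, z]"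
  by (auto simp: length_Suc_conv numeral_2_eq_2 numeral_3_eq_3)

lemma colouring_move:
  assumes "isotopy_move l r \<or> reidemeister_move l r"
    and "tangle_word (length s) l n" "tangle_word (length s) r n"
  shows "colouring l s t v U \<longleftrightarrow> colouring r s t v U"
  using assms(1)
proof
  assume "isotopy_move l r"
  then show ?thesis
  proof cases
    case (exchange i b k b')
    then have "i + ins b + k + ins b' \<le> length s" using assms(3) by auto
    then show ?thesis unfolding exchange by (rule colouring_exchange)
  next
    case (zigzag_left i)
    have "colouring (translate i [(0, Cap), (Suc 0, Cup)]) s t v U \<longleftrightarrow>
        colouring (translate i []) s t v U"
      by (rule colouring_translate_cong[where m = 1 and n = 1])
        (use zigzag_left assms(2,3) in \<open>auto simp del: colouring.simps dest!: length_1_2_3 simp: colouring_zigzag\<close>)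
    then show ?thesis unfolding zigzag_left by (simp del: colouring.simps)
  next
    case (zigzag_right i)
    have "colouring (translate i [(Suc 0, Cap), (0, Cup)]) s t v U \<longleftrightarrow>
        colouring (translate i []) s t v U"
      by (rule colouring_translate_cong[where m = 1 and n = 1])
        (use zigzag_right assms(2,3) in \<open>auto simp del: colouring.simps dest!: length_1_2_3 simp: colouring_zigzag\<close>)
    then show ?thesis unfolding zigzag_right by (simp del: colouring.simps)
  next
    case (slide_cap i c)
    have "colouring (translate i [(0, Cap), (Suc 0, Cross c)]) s t v U \<longleftrightarrow>
        colouring (translate i [(Suc 0, Cap), (0, Cross (\<not> c))]) s t v U"
      by (rule colouring_translate_cong[where m = 1 and n = 3])
        (use slide_cap assms(2,3) in \<open>auto simp del: colouring.simps dest!: length_1_2_3 simp: colouring_slide_cap\<close>)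
    then show ?thesis unfolding slide_cap by (simp del: colouring.simps)
  next
    case (slide_cup i c)
    have "colouring (translate i [(Suc 0, Cross c), (0, Cup)]) s t v U \<longleftrightarrow>
        colouring (translate i [(0, Cross (\<not> c)), (Suc 0, Cup)]) s t v U"
      by (rule colouring_translate_cong[where m = 3 and n = 1])
        (use slide_cup assms(2,3) in \<open>auto simp del: colouring.simps dest!: length_1_2_3 simp: colouring_slide_cup\<close>)
    then show ?thesis unfolding slide_cup by (simp del: colouring.simps)
  qed
next
  assume "reidemeister_move l r"
  then show ?thesis
  proof cases
    case (R1_cap i c)
    have "colouring (translate i [(0, Cap), (0, Cross c)]) s t v U \<longleftrightarrow>
        colouring (translate i [(0, Cap)]) s t v U"
      by (rule colouring_translate_cong[where m = 0 and n = 2])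
        (use R1_cap assms(2,3) in \<open>auto simp del: colouring.simps dest!: length_1_2_3 simp: colouring_R1\<close>)
    then show ?thesis unfolding R1_cap by (simp del: colouring.simps)
  next
    case (R1_cup i c)
    have "colouring (translate i [(0, Cross c), (0, Cup)]) s t v U \<longleftrightarrow>
        colouring (translate i [(0, Cup)]) s t v U"
      by (rule colouring_translate_cong[where m = 2 and n = 0])
        (use R1_cup assms(2,3) in \<open>auto simp del: colouring.simps dest!: length_1_2_3 simp: colouring_R1\<close>)
    then show ?thesis unfolding R1_cup by (simp del: colouring.simps)
  next
    case (R2 i c)
    have "colouring (translate i [(0, Cross c), (0, Cross (\<not> c))]) s t v U \<longleftrightarrow>
        colouring (translate i []) s t v U"
      by (rule colouring_translate_cong[where m = 2 and n = 2])
        (use R2 assms(2,3) in \<open>auto simp del: colouring.simps dest!: length_1_2_3 simp: colouring_R2\<close>)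
    then show ?thesis unfolding R2 by (simp del: colouring.simps)
  next
    case (R3 c\<^sub>2 c\<^sub>1 c\<^sub>3 i)
    have "colouring (translate i [(0, Cross c\<^sub>1), (Suc 0, Cross c\<^sub>2), (0, Cross c\<^sub>3)]) s t v U \<longleftrightarrow>
        colouring (translate i [(Suc 0, Cross c\<^sub>3), (0, Cross c\<^sub>2), (Suc 0, Cross c\<^sub>1)]) s t v U"
      by (rule colouring_translate_cong[where m = 3 and n = 3])
        (use R3 assms(2,3) in \<open>auto simp del: colouring.simps dest!: length_1_2_3 simp: colouring_R3\<close>)
    then show ?thesis unfolding R3 by (simp del: colouring.simps)
  qed
qed

lemma colouring_diagram_move:
  assumes "diagram_move D D'"
  shows "colouring D [] [] v U \<longleftrightarrow> colouring D' [] [] v U"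
  using assms
proof cases
  case (1 l r x y)
  \<comment> \<open>Only lines \<open>s\<close> that a colouring of \<open>x\<close> can reach
    matter. Their length is the width at which the move takes place.\<close>
  have "colouring l s t v U \<longleftrightarrow> colouring r s t v U" if x: "colouring x [] s v' U'" for s t v v' U U'
  proof -
    have "tangle_word 0 x (length s)" using colouring_length[OF x] by simp
    moreover obtain k n k' n' where "tangle_word 0 x k" "tangle_word k l n"
      "tangle_word 0 x k'" "tangle_word k' r n'"
      using 1(4,5) unfolding link_word_def tangle_word_append by blast
    ultimately have n: "tangle_word (length s) l n" "tangle_word (length s) r n'"
      using tangle_word_unique by metis+
    \<comment> \<open>The widths below the two sides of the move come from different link words;
      they agree because every move preserves the number of bottom ends.\<close>
    have "n' = n" using 1(3)
    proof
      assume "isotopy_move l r"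
      then show ?thesis using n by cases auto
    next
      assume "reidemeister_move l r"
      then show ?thesis using n by cases auto
    qed
    then show ?thesis using colouring_move[OF 1(3)] n by blast
  qed
  then have "(\<exists>s v\<^sub>1 v\<^sub>2 U\<^sub>1 U\<^sub>2. colouring x [] s v\<^sub>1 U\<^sub>1 \<and> colouring (l @ y) s [] v\<^sub>2 U\<^sub>2
      \<and> v = (v\<^sub>1 \<noteq> v\<^sub>2) \<and> U = U\<^sub>1 \<union> U\<^sub>2) \<longleftrightarrow>
    (\<exists>s v\<^sub>1 v\<^sub>2 U\<^sub>1 U\<^sub>2. colouring x [] s v\<^sub>1 U\<^sub>1 \<and> colouring (r @ y) s [] v\<^sub>2 U\<^sub>2
      \<and> v = (v\<^sub>1 \<noteq> v\<^sub>2) \<and> U = U\<^sub>1 \<union> U\<^sub>2)"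
    unfolding colouring_append[of l] colouring_append[of r] by (simp cong: conj_cong)
  then show ?thesis unfolding 1(1,2) colouring_append[of x] .
qed

lemma colouring_equivalent:
  "equivalent D D' \<Longrightarrow> colouring D [] [] v U \<longleftrightarrow> colouring D' [] [] v U"
  unfolding equivalent_def
proof (induction rule: equivclp_induct)
  case (step D' D'')
  then show ?case using colouring_diagram_move by blast
qed simp

section \<open>Colourings of split diagrams\<close>

lemma colouring_appendI:
  assumes "colouring x s r False U\<^sub>1" "colouring y r t False U\<^sub>2"
  shows "colouring (x @ y) s t False (U\<^sub>1 \<union> U\<^sub>2)"
  unfolding colouring_append
  by (intro exI conjI, rule assms(1), rule assms(2)) simp_all

text \<open>A strand of colour \<open>c\<close> over another of colour \<open>c\<close> does not
  count. \<open>U\<close> is only a subset of \<open>{c}\<close> because a word may have no strands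
  at all.\<close>

lemma colouring_constant:
  "tangle_word m w n \<Longrightarrow> \<exists>U \<subseteq> {c}. colouring w (replicate m c) (replicate n c) False U"
proof (induction m w n rule: tangle_word.induct)
  case (1 m n)
  then show ?case by (auto intro!: exI[of _ "set (replicate n c)"])
next
  case (2 m i b w n)
  let ?m = "m - ins b + outs b" and ?r = "m - i - ins b"
  from 2 have i: "i + ins b \<le> m" and "tangle_word ?m w n" by auto
  with 2 obtain U where U: "U \<subseteq> {c}" "colouring w (replicate ?m c) (replicate n c) False U"
    by blast
  have "colour_brick b (replicate (ins b) c) (replicate (outs b) c) False"
    by (cases b) (auto simp: numeral_2_eq_2)
  moreover have "replicate m c = replicate i c @ replicate (ins b) c @ replicate ?r c"
    "replicate ?m c = replicate i c @ replicate (outs b) c @ replicate ?r c"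
    using i by (simp_all add: replicate_add[symmetric])
  ultimately have "colour_slice (i, b) (replicate m c) (replicate ?m c) False"
    unfolding colour_slice.simps by (intro exI conjI) (rule length_replicate)
  then have "colouring ((i, b) # w) (replicate m c) (replicate n c) False (set (replicate m c) \<union> U)"
    unfolding colouring_Cons using U(2)
    by (intro exI[of _ "replicate ?m c"] exI[of _ False] conjI exI[of _ U]) simp_all
  moreover have "set (replicate m c) \<union> U \<subseteq> {c}" using U by auto
  ultimately show ?case by blast
qed

lemma colouring_link_nonempty:
  assumes "colouring w [] [] v U" "w \<noteq> []"
  shows "U \<noteq> {}"
proof (cases w)
  case (Cons x w')
  obtain i b where x: "x = (i, b)" by (cases x)
  from assms(1) obtain s v' U' where *: "colour_slice (i, b) [] s v'" "U = set [] \<union> U'"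
    "colouring w' s [] (v \<noteq> v') U'" unfolding Cons x colouring_Cons by blast
  then have "s \<noteq> []" using colour_slice_length[OF *(1)] by (cases b) auto
  moreover have "set s \<subseteq> U'" using *(3) by (cases w') auto
  ultimately show ?thesis using *(2) by auto
qed (use assms in simp)

text \<open>In the split form the inside of the circle is coloured \<open>True\<close> and the
  outside \<open>False\<close>. Both parts are monochrome and do not cross each other, so the parity
  is even; invariance carries this back to \<open>D\<close>.\<close>

lemma splittable_colouring:
  assumes "splittable D"
  shows "colouring D [] [] False UNIV"
proof -
  from assms obtain x w y k where *: "equivalent D (x @ translate k w @ y)"
    "link_word (x @ translate k w @ y)" "link_word w" "w \<noteq> []" "link_word (x @ y)" "x @ y \<noteq> []"
    unfolding splittable_def by blast
  from *(5) obtain m where m: "tangle_word 0 x m" "tangle_word m y 0"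
    by (auto simp: link_word_def tangle_word_append)
  \<comment> \<open>The line is to be cut into \<open>k\<close> and \<open>m - k\<close> strands
    around the inner link. It is long enough because the first slice of \<open>w\<close> already has
    \<open>k\<close> strands to its left.\<close>
  have "k \<le> m"
  proof (cases w)
    case (Cons z w')
    obtain i b where z: "z = (i, b)" by (cases z)
    obtain m' n where "tangle_word 0 x m'" "tangle_word m' (translate k w) n"
      using *(2) unfolding link_word_def tangle_word_append by blast
    then have "tangle_word m (translate k w) n" using tangle_word_unique[OF m(1)] by simp
    then show ?thesis by (auto simp: Cons z)
  qed (use *(4) in simp)
  obtain U\<^sub>1 where x: "U\<^sub>1 \<subseteq> {False}" "colouring x [] (replicate m False) False U\<^sub>1"
    using colouring_constant[OF m(1), of False] by auto
  obtain U\<^sub>2 where y: "U\<^sub>2 \<subseteq> {False}" "colouring y (replicate m False) [] False U\<^sub>2"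
    using colouring_constant[OF m(2), of False] by auto
  obtain U\<^sub>3 where w: "U\<^sub>3 \<subseteq> {True}" "colouring w [] [] False U\<^sub>3"
    using colouring_constant[of 0 w 0 True] *(3) by (auto simp: link_word_def)
  have "colouring (x @ y) [] [] False (U\<^sub>1 \<union> U\<^sub>2)"
    using x(2) y(2) by (rule colouring_appendI)
  \<comment> \<open>One of \<open>x\<close> and \<open>y\<close> may be empty and use no colour, so
    \<open>False\<close> is only known to occur in the two together.\<close>
  then have "U\<^sub>1 \<union> U\<^sub>2 \<noteq> {}" using *(6) by (rule colouring_link_nonempty)
  then have U12: "U\<^sub>1 \<union> U\<^sub>2 = {False}" using x(1) y(1) by blast
  have "U\<^sub>3 \<noteq> {}" using w(2) *(4) by (rule colouring_link_nonempty)
  then have U3: "U\<^sub>3 = {True}" using w(1) by blast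
  have m': "replicate m False = replicate k False @ [] @ replicate (m - k) False"
    using \<open>k \<le> m\<close> by (simp add: replicate_add[symmetric])
  have "tangle_word (length []) w 0" using *(3) by (simp add: link_word_def)
  then have "colouring (translate k w) (replicate m False) (replicate m False) False
      (set (replicate k False) \<union> set (replicate (m - k) False) \<union> U\<^sub>3)" (is "colouring _ _ _ _ ?U")
    unfolding m' by (subst colouring_widen) (use w in auto)
  then have "colouring (x @ translate k w @ y) [] [] False (U\<^sub>1 \<union> (?U \<union> U\<^sub>2))"
    using x(2) y(2) by (intro colouring_appendI)
  moreover have "U\<^sub>1 \<union> (?U \<union> U\<^sub>2) = UNIV"
    using U12 U3 unfolding UNIV_bool by auto
  ultimately have "colouring (x @ translate k w @ y) [] [] False UNIV" by (simp only:)
  then show ?thesis using colouring_equivalent[OF *(1)] by simp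
qed

section \<open>From components to colourings\<close>

lemma width_Suc:
  "k < length w \<Longrightarrow> w ! k = (i, b) \<Longrightarrow> width w (Suc k) = width w k - ins b + outs b"
  by (simp add: width_def take_Suc_conv_app_nth)

lemma tangle_word_drop:
  assumes "tangle_word 0 w n" "k \<le> length w"
  shows "tangle_word (width w k) (drop k w) n"
  using assms(2)
proof (induction k)
  case 0
  then show ?case using assms(1) by (simp add: width_def)
next
  case (Suc k)
  obtain i b where ib: "w ! k = (i, b)" by (cases "w ! k")
  have "drop k w = (i, b) # drop (Suc k) w"
    using Suc(2) ib by (metis Cons_nth_drop_Suc Suc_le_eq)
  moreover have "width w (Suc k) = width w k - ins b + outs b"
    using Suc(2) ib by (intro width_Suc) auto
  moreover have "tangle_word (width w k) (drop k w) n" using Suc by simp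
  ultimately show ?case by (simp only: tangle_word.simps)
qed

lemma map_upt_split3:
  "map g [0..<i + j + r] = map g [0..<i] @ map g [i..<i + j] @ map (\<lambda>p. g (i + j + p)) [0..<r]"
  by (rule nth_equalityI) (auto simp: nth_append)

lemma strand_step_colour_slice:
  assumes k: "k < length w" "w ! k = (i, b)" and i: "i + ins b \<le> width w k"
    and f: "\<And>x y. strand_step w x y \<Longrightarrow> f x = f y"
  shows "\<exists>v. colour_slice (i, b) (map (\<lambda>p. f (k, p)) [0..<width w k])
    (map (\<lambda>p. f (Suc k, p)) [0..<width w (Suc k)]) v"
proof -
  define r where "r = width w k - i - ins b"
  have wd: "width w k = i + ins b + r" "width w (Suc k) = i + outs b + r"
    using i by (auto simp: r_def width_Suc[OF k])
  define p q where "p = map (\<lambda>p. f (k, p)) [i..<i + ins b]"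
    and "q = map (\<lambda>p. f (Suc k, p)) [i..<i + outs b]"
  have left: "map (\<lambda>p. f (Suc k, p)) [0..<i] = map (\<lambda>p. f (k, p)) [0..<i]"
    using f[OF strand_step.left[OF k]] by auto
  have right: "map (\<lambda>p. f (Suc k, i + outs b + p)) [0..<r] = map (\<lambda>p. f (k, i + ins b + p)) [0..<r]"
    using f[OF strand_step.right[OF k]] wd by auto
  have "\<exists>v. colour_brick b p q v"
  proof (cases b)
    case Cap
    then show ?thesis using f[OF strand_step.cap] k by (auto simp: p_def q_def upt_rec)
  next
    case Cup
    then show ?thesis using f[OF strand_step.cup] k by (auto simp: p_def q_def upt_rec)
  next
    case (Cross c)
    then show ?thesis using f[OF strand_step.cross_falling] f[OF strand_step.cross_rising] k
      by (auto simp: p_def q_def upt_rec)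
  qed
  then obtain v where v: "colour_brick b p q v" ..
  have "map (\<lambda>p. f (k, p)) [0..<width w k] =
      map (\<lambda>p. f (k, p)) [0..<i] @ p @ map (\<lambda>p. f (k, i + ins b + p)) [0..<r]"
    unfolding wd p_def by (rule map_upt_split3)
  moreover have "map (\<lambda>p. f (Suc k, p)) [0..<width w (Suc k)] =
      map (\<lambda>p. f (k, p)) [0..<i] @ q @ map (\<lambda>p. f (k, i + ins b + p)) [0..<r]"
    unfolding wd q_def map_upt_split3 left right ..
  ultimately have "colour_slice (i, b) (map (\<lambda>p. f (k, p)) [0..<width w k])
    (map (\<lambda>p. f (Suc k, p)) [0..<width w (Suc k)]) v"
    unfolding colour_slice.simps using v by (intro exI conjI) (simp_all only: length_map length_upt diff_zero)
  then show ?thesis ..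
qed

text \<open>A function that is constant along strands is read off line by line. The induction runs
  upwards over the suffixes \<open>drop k w\<close>, as \<open>colouring\<close> recurses on the
  word, and collects the colours of all lines below.\<close>

lemma strand_step_colouring:
  assumes w: "tangle_word 0 w 0"
    and f: "\<And>x y. strand_step w x y \<Longrightarrow> f x = f y"
  shows "\<exists>v. colouring w [] [] v (f ` points w)"
proof -
  let ?level = "\<lambda>k. map (\<lambda>p. f (k, p)) [0..<width w k]"
  have "\<exists>v. colouring (drop k w) (?level k) (?level (length w)) v
      (\<Union>j\<in>{k..length w}. set (?level j))" if "k \<le> length w" for k
    using that
  proof (induction k rule: inc_induct)
    case base
    show ?case by (intro exI[of _ False]) auto
  next
    case (step k)
    obtain i b where ib: "w ! k = (i, b)" by (cases "w ! k")
    have drop: "drop k w = (i, b) # drop (Suc k) w"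
      using step(2) ib by (metis Cons_nth_drop_Suc)
    have "i + ins b \<le> width w k"
      using tangle_word_drop[OF w, of k] step(2) by (simp add: drop)
    then obtain v where v: "colour_slice (i, b) (?level k) (?level (Suc k)) v"
      using strand_step_colour_slice[OF step(2) ib] f by blast
    from step(3) obtain v' where v': "colouring (drop (Suc k) w) (?level (Suc k)) (?level (length w)) v'
      (\<Union>j\<in>{Suc k..length w}. set (?level j))" ..
    have U: "(\<Union>j\<in>{k..length w}. set (?level j)) =
        set (?level k) \<union> (\<Union>j\<in>{Suc k..length w}. set (?level j))"
      using step(2) by (subst atLeastAtMost_insertL[symmetric]) auto
    show ?case unfolding drop colouring.simps U
      using v v' by (intro exI[of _ "v \<noteq> v'"] exI conjI) (assumption | rule refl)+
  qed
  from this[of 0] obtain v where v: "colouring w [] (?level (length w)) v (\<Union>j\<in>{0..length w}. set (?level j))"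
    by (auto simp: width_def simp del: colouring.simps)
  have "width w (length w) = 0" using tangle_word_drop[OF w, of "length w"] by simp
  moreover have "(\<Union>j\<in>{0..length w}. set (?level j)) = f ` points w"
    by (auto simp: points_def)
  ultimately show ?thesis using v by auto
qed

text \<open>One component is coloured \<open>True\<close> and the rest \<open>False\<close>; a
  second equivalence class ensures that both colours occur. The parity is whatever the labels make
  it.\<close>

lemma two_component_colouring:
  assumes "two_component_link w"
  shows "\<exists>v. colouring w [] [] v UNIV"
proof -
  let ?R = "{(x, y). equivclp (strand_step w) x y}"
  have "card (points w // ?R) = 2" and w: "tangle_word 0 w 0"
    using assms by (auto simp: two_component_link_def components_def link_word_def)
  then obtain X Y where XY: "X \<in> points w // ?R" "Y \<in> points w // ?R" "X \<noteq> Y"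
    by (metis card_2_iff insertCI)
  then obtain x y where x: "x \<in> points w" "X = ?R `` {x}" and y: "y \<in> points w" "Y = ?R `` {y}"
    by (auto elim!: quotientE)
  define f where "f z = equivclp (strand_step w) x z" for z
  have "f x" by (simp add: f_def)
  moreover have "\<not> f y"
  proof
    assume *: "f y"
    have "X = Y" unfolding x y
      using * unfolding f_def by (auto intro: equivclp_trans equivclp_sym)
    with XY show False by simp
  qed
  ultimately have "f ` points w = UNIV" using x(1) y(1) unfolding UNIV_bool by blast
  moreover have "f z = f z'" if "strand_step w z z'" for z z'
    using that unfolding f_def by (meson equivclp_into_equivclp equivclp_sym equivclp_trans r_into_equivclp)
  ultimately show ?thesis using strand_step_colouring[OF w, of f] by auto
qed

section \<open>Colourings of rational tangles\<close>

text \<open>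
  The state \<open>(ne, sw, se, v)\<close> consists of the colours of three of the endpoints (the colour of NW
  never changes) and of the parity \<open>v\<close> of \<^const>\<open>colouring\<close>.
\<close>

fun twist_colours :: "bool \<times> bool \<Rightarrow> bool \<times> bool \<times> bool \<times> bool \<Rightarrow> bool \<times> bool \<times> bool \<times> bool" where
  "twist_colours (k, c) (ne, sw, se, v) =
    (if k then (ne, se, sw, v \<noteq> (if c then se \<and> \<not> sw else sw \<and> \<not> se))
     else (se, sw, ne, v \<noteq> (if c then se \<and> \<not> ne else ne \<and> \<not> se)))"

lemma colouring_2:
  "colouring ((2, Cap) # w) (x # y # s) t v U \<longleftrightarrow>
    (\<exists>a U'. colouring w (x # y # a # a # s) t v U' \<and> U = set (x # y # s) \<union> U')"
  "colouring ((2, Cross c) # w) (x # y # a # b # s) t v U \<longleftrightarrow>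
    (\<exists>U'. colouring w (x # y # b # a # s) t (v \<noteq> (if c then b \<and> \<not> a else a \<and> \<not> b)) U'
      \<and> U = set (x # y # a # b # s) \<union> U')"
  unfolding colouring_Cons numeral_2_eq_2 colour_slice_Suc colour_slice_Cap colour_slice_Cross
  by (safe; fastforce)+

lemma colouring_tangle_bottom:
  assumes "colouring T [x, y] t v U" "tangle_word 2 T 2"
  shows "\<exists>p q. t = [p, q]"
proof -
  have "length t = 2"
    using colouring_length[OF assms(1)] tangle_word_unique[OF assms(2)] by (simp add: numeral_2_eq_2)
  then show ?thesis by (rule length_1_2_3)
qed

lemma colouring_bottom_twist:
  assumes "colouring (bottom_twist c T) [x, y] [p, q] v U" "tangle_word 2 T 2"
  shows "\<exists>v' U'. colouring T [x, y] [q, p] v' U' \<and> v = (v' \<noteq> (if c then p \<and> \<not> q else q \<and> \<not> p))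
    \<and> U = {p, q} \<union> U'"
proof -
  from assms(1) obtain r v\<^sub>1 v\<^sub>2 U\<^sub>1 U\<^sub>2 where *: "colouring T [x, y] r v\<^sub>1 U\<^sub>1"
    "colouring [(0, Cross c)] r [p, q] v\<^sub>2 U\<^sub>2" "v = (v\<^sub>1 \<noteq> v\<^sub>2)" "U = U\<^sub>1 \<union> U\<^sub>2"
    unfolding bottom_twist_def colouring_append by blast
  from colouring_tangle_bottom[OF *(1) assms(2)] obtain p' q' where r: "r = [p', q']" by blast
  have 2: "p' = q" "q' = p" "v\<^sub>2 = (if c then p \<and> \<not> q else q \<and> \<not> p)" "U\<^sub>2 = {p, q}"
    using *(2) unfolding r colouring_0 by auto
  show ?thesis
    by (intro exI[of _ v\<^sub>1] exI[of _ U\<^sub>1] conjI) (use * 2 r in \<open>auto simp del: if_split\<close>)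
qed

text \<open>The cap gives the old NE a colour that leaves the crossing as the new SE, and the cup
  forces the old SE to match the new NE. In colours, a right twist therefore swaps NE and
  SE.\<close>

lemma colouring_right_twist:
  assumes "colouring (right_twist c T) [x, y] [p, q] v U" "tangle_word 2 T 2"
  shows "\<exists>v' U'. colouring T [x, q] [p, y] v' U' \<and> v = (v' \<noteq> (if c then y \<and> \<not> q else q \<and> \<not> y))
    \<and> U = {y, q} \<union> U' \<union> {x, p}"
proof -
  from assms(1) obtain a U' where 1: "colouring (T @ [(2, Cross c), (Suc 0, Cup)]) [x, a, a, y] [p, q] v U'"
    "U = {x, y} \<union> U'"
    by (auto simp: right_twist_def colouring_1 simp del: colouring.simps)
  from 1(1) obtain r v\<^sub>1 v\<^sub>2 U\<^sub>1 U\<^sub>2 where 2: "colouring T [x, a, a, y] r v\<^sub>1 U\<^sub>1"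
    "colouring [(2, Cross c), (Suc 0, Cup)] r [p, q] v\<^sub>2 U\<^sub>2" "v = (v\<^sub>1 \<noteq> v\<^sub>2)" "U' = U\<^sub>1 \<union> U\<^sub>2"
    unfolding colouring_append by blast
  have "colouring (translate 0 T) ([] @ [x, a] @ [a, y]) r v\<^sub>1 U\<^sub>1" using 2(1) by simp
  moreover have "tangle_word (length [x, a]) T 2" using assms(2) by (simp add: numeral_2_eq_2)
  ultimately obtain t' V where 3: "r = t' @ [a, y]" "colouring T [x, a] t' v\<^sub>1 V" "U\<^sub>1 = {a, y} \<union> V"
    by (subst (asm) colouring_widen) auto
  from colouring_tangle_bottom[OF 3(2) assms(2)] obtain p' q' where t': "t' = [p', q']" by blast
  have r: "r = [p', q', a, y]" using 3(1) t' by simp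
  have 4: "p' = p" "q' = y" "a = q" "v\<^sub>2 = (if c then y \<and> \<not> q else q \<and> \<not> y)" "U\<^sub>2 = {p, y, q}"
    using 2(2) unfolding r colouring_2 by (auto simp: colouring_1 simp del: colouring.simps(2))
  have U: "U = {y, q} \<union> V \<union> {x, p}" using 1(2) 2(4) 3(3) 4 by auto
  show ?thesis
    by (intro exI[of _ v\<^sub>1] exI[of _ V] conjI U)
      (use 2(3) 3(2) 4 t' in \<open>auto simp del: if_split\<close>)
qed

text \<open>The empty tangle has two vertical strands: NW and SW have colour \<open>nw\<close>, NE
  and SE a colour \<open>b\<close>. Twists only permute the ends, so no third choice arises.\<close>

lemma colouring_twists:
  "colouring (twists tw) [nw, ne] [sw, se] v U \<Longrightarrow>
    \<exists>b. fold twist_colours tw (b, nw, b, False) = (ne, sw, se, v) \<and> U = {nw, b} \<and> {ne, sw, se} \<subseteq> U"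
proof (induction tw arbitrary: ne sw se v U rule: rev_induct)
  case Nil
  then show ?case by (auto simp: twists_def)
next
  case (snoc x tw)
  obtain k c where x: "x = (k, c)" by (cases x)
  have T: "tangle_word 2 (twists tw) 2" by (rule tangle_word_twists)
  show ?case
  proof (cases k)
    case True
    then have "colouring (bottom_twist c (twists tw)) [nw, ne] [sw, se] v U"
      using snoc(2) by (simp add: twists_def twist_def x)
    from colouring_bottom_twist[OF this T] obtain v' U' where *:
      "colouring (twists tw) [nw, ne] [se, sw] v' U'"
      "v = (v' \<noteq> (if c then sw \<and> \<not> se else se \<and> \<not> sw))" "U = {sw, se} \<union> U'" by blast
    from snoc(1)[OF *(1)] obtain b where b: "fold twist_colours tw (b, nw, b, False) = (ne, se, sw, v')"
      "U' = {nw, b}" "{ne, se, sw} \<subseteq> U'" by blast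
    have "fold twist_colours (tw @ [x]) (b, nw, b, False) = (ne, sw, se, v)"
      by (simp add: b(1) x True *(2) del: if_split)
    moreover have "U = U'" using *(3) b(3) by blast
    ultimately show ?thesis using b(2,3) by blast
  next
    case False
    then have "colouring (right_twist c (twists tw)) [nw, ne] [sw, se] v U"
      using snoc(2) by (simp add: twists_def twist_def x)
    from colouring_right_twist[OF this T] obtain v' U' where *:
      "colouring (twists tw) [nw, se] [sw, ne] v' U'"
      "v = (v' \<noteq> (if c then ne \<and> \<not> se else se \<and> \<not> ne))" "U = {ne, se} \<union> U' \<union> {nw, sw}" by blast
    from snoc(1)[OF *(1)] obtain b where b: "fold twist_colours tw (b, nw, b, False) = (se, sw, ne, v')"
      "U' = {nw, b}" "{se, sw, ne} \<subseteq> U'" by blast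
    have "fold twist_colours (tw @ [x]) (b, nw, b, False) = (ne, sw, se, v)"
      by (simp add: b(1) x False *(2) del: if_split)
    moreover have "nw \<in> U'" unfolding b(2) by simp
    then have "U = U'" using *(3) b(3) by blast
    ultimately show ?thesis using b(2,3) by blast
  qed
qed

text \<open>The closing arcs force NE to equal NW and SW to equal SE. All colours lie in
  \<open>{a, b}\<close> and both occur, so the initial right strand has colour
  \<open>\<not> a\<close>.\<close>

lemma colouring_numerator_closure:
  assumes "colouring (numerator_closure (twists tw)) [] [] v UNIV"
  shows "\<exists>a y. fold twist_colours tw (\<not> a, a, \<not> a, False) = (a, y, y, v)"
proof -
  from assms obtain a U' where 1: "colouring (twists tw @ [(0, Cup)]) [a, a] [] v U'" "UNIV = U'"
    by (auto simp: numerator_closure_def colouring_0 simp del: colouring.simps)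
  from 1(1) obtain r v\<^sub>1 v\<^sub>2 U\<^sub>1 U\<^sub>2 where 2: "colouring (twists tw) [a, a] r v\<^sub>1 U\<^sub>1"
    "colouring [(0, Cup)] r [] v\<^sub>2 U\<^sub>2" "v = (v\<^sub>1 \<noteq> v\<^sub>2)" "U' = U\<^sub>1 \<union> U\<^sub>2"
    unfolding colouring_append by blast
  from colouring_tangle_bottom[OF 2(1) tangle_word_twists] obtain p q where r: "r = [p, q]" by blast
  have 3: "p = q" "\<not> v\<^sub>2" "U\<^sub>2 = {p}" using 2(2) unfolding r colouring_0 by auto
  from colouring_twists[OF 2(1)[unfolded r 3(1)]] obtain b where
    b: "fold twist_colours tw (b, a, b, False) = (a, q, q, v\<^sub>1)" "U\<^sub>1 = {a, b}" "{a, q, q} \<subseteq> U\<^sub>1" by blast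
  have "U\<^sub>2 \<subseteq> U\<^sub>1" using 3 b(3) by simp
  then have "{a, b} = UNIV" using 1(2) 2(4) b(2) by blast
  then have "b = (\<not> a)" unfolding UNIV_bool by (cases a; cases b) auto
  moreover have "v\<^sub>1 = v" using 2(3) 3(2) by simp
  ultimately show ?thesis using b(1) by blast
qed

lemma colouring_denominator_closure:
  assumes "colouring (denominator_closure (twists tw)) [] [] v UNIV"
  shows "\<exists>a y. fold twist_colours tw (\<not> a, a, \<not> a, False) = (y, a, y, v)"
proof -
  from assms obtain a y U' where
    1: "colouring (translate 1 (twists tw) @ [(0, Cup), (0, Cup)]) [a, a, y, y] [] v U'" "UNIV = {a} \<union> U'"
    by (auto simp: denominator_closure_def colouring_0 colouring_2 simp del: colouring.simps)
  from 1(1) obtain r v\<^sub>1 v\<^sub>2 U\<^sub>1 U\<^sub>2 where 2: "colouring (translate 1 (twists tw)) [a, a, y, y] r v\<^sub>1 U\<^sub>1"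
    "colouring [(0, Cup), (0, Cup)] r [] v\<^sub>2 U\<^sub>2" "v = (v\<^sub>1 \<noteq> v\<^sub>2)" "U' = U\<^sub>1 \<union> U\<^sub>2"
    unfolding colouring_append by blast
  have "colouring (translate 1 (twists tw)) ([a] @ [a, y] @ [y]) r v\<^sub>1 U\<^sub>1" using 2(1) by simp
  moreover have "tangle_word (length [a, y]) (twists tw) 2"
    using tangle_word_twists by (simp add: numeral_2_eq_2)
  ultimately obtain t V where 3: "r = [a] @ t @ [y]" "colouring (twists tw) [a, y] t v\<^sub>1 V"
    "U\<^sub>1 = {a, y} \<union> V"
    by (subst (asm) colouring_widen) auto
  from colouring_tangle_bottom[OF 3(2) tangle_word_twists] obtain p q where t: "t = [p, q]" by blast
  have r: "r = [a, p, q, y]" using 3(1) t by simp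
  have 4: "p = a" "q = y" "\<not> v\<^sub>2" "U\<^sub>2 = {a, y}"
    using 2(2) unfolding r colouring_0 by auto
  from colouring_twists[OF 3(2)[unfolded t 4]] obtain b where
    b: "fold twist_colours tw (b, a, b, False) = (y, a, y, v\<^sub>1)" "V = {a, b}" "{y, a, y} \<subseteq> V" by blast
  have "U\<^sub>1 \<union> U\<^sub>2 \<union> {a} \<subseteq> V" using 3(3) 4(4) b(3) by simp
  then have "{a, b} = UNIV" using 1(2) 2(4) b(2) by blast
  then have "b = (\<not> a)" unfolding UNIV_bool by (cases a; cases b) auto
  moreover have "v\<^sub>1 = v" using 2(3) 4(3) by simp
  ultimately show ?thesis using b(1) by blast
qed

section \<open>Pairing strategies\<close>

lemma to_move_second: "to_move (opponent P) h = P \<longleftrightarrow> odd (length h)"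
  by (cases P) (auto simp: to_move_def)

text \<open>\<open>\<pi>\<close> gives the partner of a crossing, and \<open>e\<close> tells whether
  the reply negates the label. After each reply the set of resolved crossings is closed under
  \<open>\<pi>\<close>, so the next reply is legal.\<close>

lemma involution_strategy:
  assumes inv: "\<And>x. x \<in> crossings S \<Longrightarrow>
      \<pi> x \<in> crossings S \<and> \<pi> x \<noteq> x \<and> \<pi> (\<pi> x) = x \<and> e (\<pi> x) = e x"
    and win: "\<And>r. \<forall>x\<in>crossings S. r (\<pi> x) = (r x \<noteq> e x) \<Longrightarrow> wins P (resolve S r)"
  shows "has_winning_strategy S (opponent P) P"
proof -
  \<comment> \<open>\<open>last h\<close> is the opponent's latest move. \<open>P\<close> is to move
    only at odd length, so \<open>h\<close> is never empty when it matters.\<close>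
  define \<sigma> :: "play \<Rightarrow> nat \<times> bool" where
    "\<sigma> h = (\<pi> (fst (last h)), snd (last h) \<noteq> e (fst (last h)))" for h
  have reply: "h ! k = (\<pi> (fst (h ! (k - 1))), snd (h ! (k - 1)) \<noteq> e (fst (h ! (k - 1))))"
    if "follows \<sigma> (opponent P) P h" "k < length h" "odd k" for h k
  proof -
    have "h ! k = \<sigma> (take k h)"
      using that by (simp add: follows_def to_move_second)
    moreover have "k = Suc (k - 1)" using that(3) by (cases k) auto
    then have "last (take k h) = h ! (k - 1)"
      using that(2) by (metis Suc_lessD last_snoc take_Suc_conv_app_nth)
    ultimately show ?thesis by (simp add: \<sigma>_def)
  qed
  have fresh: "\<pi> (fst (last h)) \<notin> fst ` set h"
    if h: "legal_play S h" "follows \<sigma> (opponent P) P h" "odd (length h)" for h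
  proof
    define n where "n = length h - 1"
    have n: "n < length h" "even n" "last h = h ! n"
      using h(3) by (cases "h = []"; simp add: n_def last_conv_nth)+
    have dist: "i = j" if "i < length h" "j < length h" "fst (h ! i) = fst (h ! j)" for i j
      using h(1) that by (simp add: legal_play_def distinct_conv_nth) (metis length_map nth_map)
    have cross: "fst (h ! j) \<in> crossings S" if "j < length h" for j
      using h(1) that by (auto simp: legal_play_def)
    assume "\<pi> (fst (last h)) \<in> fst ` set h"
    then obtain j where j: "j < length h" "fst (h ! j) = \<pi> (fst (h ! n))"
      using n(3) by (auto simp: in_set_conv_nth)
    have "j \<noteq> n" using j inv[OF cross[OF n(1)]] by auto
    show False
    proof (cases "even j")
      case True
      \<comment> \<open>The opponent's move \<open>j\<close> was answered at \<open>j + 1\<close> in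
        the crossing of move \<open>n\<close>, before move \<open>n\<close> was made.\<close>
      have "j < n" using j(1) \<open>j \<noteq> n\<close> by (auto simp: n_def)
      then have "j + 1 < n" using True n(2) by presburger
      then have "fst (h ! (j + 1)) = \<pi> (\<pi> (fst (h ! n)))"
        using reply[OF h(2), of "j + 1"] True n(1) j(2) by simp
      then have "j + 1 = n"
        using dist[of "j + 1" n] inv[OF cross[OF n(1)]] \<open>j + 1 < n\<close> n(1) by simp
      with \<open>j + 1 < n\<close> show False by simp
    next
      case False
      \<comment> \<open>Move \<open>j\<close> answered move \<open>j - 1\<close>, which thus took
        the crossing of move \<open>n\<close>; but \<open>n\<close> is the last index.\<close>
      then have "fst (h ! j) = \<pi> (fst (h ! (j - 1)))" using reply[OF h(2) j(1)] by simp
      then have "fst (h ! (j - 1)) = fst (h ! n)"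
        using j inv[OF cross[of "j - 1"]] inv[OF cross[OF n(1)]] by simp
      then have "j - 1 = n" using dist[of "j - 1" n] j(1) n(1) by simp
      then show False using False j(1) by (cases j) (auto simp: n_def)
    qed
  qed
  have "legal_play S (h @ [\<sigma> h])"
    if "legal_play S h" "follows \<sigma> (opponent P) P h" "to_move (opponent P) h = P" for h
  proof -
    have len: "odd (length h)" using that(3) by (simp add: to_move_second)
    then have "last h \<in> set h" by (intro last_in_set) auto
    then have "\<pi> (fst (last h)) \<in> crossings S"
      using that(1) inv by (auto simp: legal_play_def)
    then show ?thesis using fresh[OF that(1,2) len] that(1) by (auto simp: legal_play_def \<sigma>_def)
  qed
  moreover have "wins P (outcome S h)"
    if h: "complete_play S h" "follows \<sigma> (opponent P) P h" for h
    unfolding outcome_def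
  proof (rule win, intro ballI)
    fix x assume x: "x \<in> crossings S"
    let ?r = "\<lambda>k. the (map_of h k)"
    have legal: "legal_play S h" using h(1) by (simp add: complete_play_def legal_play_def)
    have r: "?r (fst (h ! j)) = snd (h ! j)" if "j < length h" for j
    proof -
      have "distinct (map fst h)" using h(1) by (simp add: complete_play_def)
      moreover have "(fst (h ! j), snd (h ! j)) \<in> set h" using that by simp
      ultimately show ?thesis by (simp only: map_of_is_SomeI option.sel)
    qed
    from x have "x \<in> fst ` set h" using h(1) by (simp add: complete_play_def)
    then obtain j where j: "j < length h" "x = fst (h ! j)"
      by (metis imageE in_set_conv_nth)
    show "?r (\<pi> x) = (?r x \<noteq> e x)"
    proof (cases "even j")
      case True
      \<comment> \<open>A complete play cannot end with a move of the opponent, as the partner of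
        its crossing would still be unresolved.\<close>
      have "j + 1 \<noteq> length h"
      proof
        assume len: "j + 1 = length h"
        then have "last h = h ! j" by (cases "h = []") (simp_all add: last_conv_nth len[symmetric])
        moreover have "odd (length h)" using True len by (simp add: len[symmetric])
        ultimately have "\<pi> x \<notin> fst ` set h" using fresh[OF legal h(2)] j(2) by simp
        then show False using inv[OF x] h(1) by (simp add: complete_play_def)
      qed
      then have "h ! (j + 1) = (\<pi> x, snd (h ! j) \<noteq> e x)" "j + 1 < length h"
        using reply[OF h(2), of "j + 1"] j True by simp_all
      then show ?thesis using r[of j] r[of "j + 1"] j by simp
    next
      case False
      then have *: "h ! j = (\<pi> (fst (h ! (j - 1))), snd (h ! (j - 1)) \<noteq> e (fst (h ! (j - 1))))"
        using reply[OF h(2) j(1)] by simp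
      have "fst (h ! (j - 1)) \<in> crossings S"
        using legal j(1) by (auto simp: legal_play_def)
      from inv[OF this] have "\<pi> x = fst (h ! (j - 1))" "e x = e (fst (h ! (j - 1)))"
        using * j(2) by simp_all
      then show ?thesis using r[of j] r[of "j - 1"] j * by (auto split: if_splits)
    qed
  qed
  ultimately show ?thesis unfolding has_winning_strategy_def by blast
qed

text \<open>The opponent may open a pair at either crossing. \<open>e\<close> copies
  \<open>d x\<close> to both members, because \<open>r y = (r x \<noteq> d x)\<close> is symmetric
  in the two labels.\<close>

lemma pairing_involution:
  "distinct (concat (map (\<lambda>(x, y). [x, y]) qs)) \<Longrightarrow>
    \<exists>\<pi> e. \<forall>(x, y)\<in>set qs. \<pi> x = y \<and> \<pi> y = x \<and> e x = d x \<and> e y = d x"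
proof (induction qs)
  case (Cons q qs)
  obtain x y where q: "q = (x, y)" by (cases q)
  from Cons obtain \<pi> e where *: "\<forall>(x, y)\<in>set qs. \<pi> x = y \<and> \<pi> y = x \<and> e x = d x \<and> e y = d x"
    by auto
  have "\<forall>(x', y')\<in>set qs. x' \<notin> {x, y} \<and> y' \<notin> {x, y}"
    using Cons(2) by (auto simp: q)
  then show ?case using * Cons(2)
    by (intro exI[of _ "\<pi>(x := y, y := x)"] exI[of _ "e(x := d x, y := d x)"]) (auto simp: q)
qed simp

lemma pairing_strategy:
  fixes d :: "nat \<Rightarrow> bool"
  assumes "distinct (concat (map (\<lambda>(x, y). [x, y]) qs))"
    and cross: "set (concat (map (\<lambda>(x, y). [x, y]) qs)) = crossings S"
    and win: "\<And>r. \<forall>(x, y)\<in>set qs. r y = (r x \<noteq> d x) \<Longrightarrow> wins P (resolve S r)"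
  shows "has_winning_strategy S (opponent P) P"
proof -
  obtain \<pi> e where *: "\<forall>(x, y)\<in>set qs. \<pi> x = y \<and> \<pi> y = x \<and> e x = d x \<and> e y = d x"
    using pairing_involution[OF assms(1)] by blast
  have neq: "x \<noteq> y" if "(x, y) \<in> set qs" for x y
  proof -
    from that obtain us vs where "qs = us @ (x, y) # vs" by (auto dest: split_list)
    then show ?thesis using assms(1) by auto
  qed
  have mem: "z \<in> crossings S \<longleftrightarrow> (\<exists>(x, y)\<in>set qs. z = x \<or> z = y)" for z
    unfolding cross[symmetric] by auto
  show ?thesis
  proof (rule involution_strategy)
    show "\<pi> z \<in> crossings S \<and> \<pi> z \<noteq> z \<and> \<pi> (\<pi> z) = z \<and> e (\<pi> z) = e z" if "z \<in> crossings S" for z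
    proof -
      from that obtain x y where xy: "(x, y) \<in> set qs" "z = x \<or> z = y" unfolding mem by auto
      then have "x \<in> crossings S" "y \<in> crossings S" unfolding mem by auto
      with xy * neq[OF xy(1)] show ?thesis by fastforce
    qed
    show "wins P (resolve S r)" if r: "\<forall>x\<in>crossings S. r (\<pi> x) = (r x \<noteq> e x)" for r
    proof (rule win, clarify)
      fix x y assume xy: "(x, y) \<in> set qs"
      then have "x \<in> crossings S" unfolding mem by auto
      moreover have "\<pi> x = y" "e x = d x" using * xy by auto
      ultimately show "r y = (r x \<noteq> d x)" using r by auto
    qed
  qed
qed

section \<open>Resolving the crossings of a closure\<close>

text \<open>Indices in the word shift whenever a cap is put on top. In the order of height the
  crossings can be addressed by their rank instead.\<close>

definition crossing_list :: "'c word \<Rightarrow> nat list" where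
  "crossing_list w = filter (\<lambda>k. \<exists>i c. w ! k = (i, Cross c)) [0..<length w]"

text \<open>\<open>resolve\<close> with the labels given as a list from top to bottom, which splits
  along concatenation.\<close>

fun fill :: "shadow \<Rightarrow> bool list \<Rightarrow> diagram" where
  "fill [] ls = []"
| "fill ((i, Cap) # w) ls = (i, Cap) # fill w ls"
| "fill ((i, Cup) # w) ls = (i, Cup) # fill w ls"
| "fill ((i, Cross c) # w) ls = (i, Cross (hd ls)) # fill w (tl ls)"

lemma distinct_crossing_list: "distinct (crossing_list w)"
  by (simp add: crossing_list_def)

lemma set_crossing_list: "set (crossing_list w) = crossings w"
  by (auto simp: crossing_list_def crossings_def)

lemma crossing_list_Nil [simp]: "crossing_list [] = []"
  by (simp add: crossing_list_def)

lemma crossing_list_Cons: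
  "crossing_list (x # w) = (if \<exists>i c. x = (i, Cross c) then [0] else []) @ map Suc (crossing_list w)"
proof -
  have "[0..<length (x # w)] = 0 # map Suc [0..<length w]"
    by (simp add: upt_conv_Cons map_Suc_upt del: upt_Suc)
  then show ?thesis by (simp add: crossing_list_def filter_map o_def)
qed

lemma crossing_list_simps [simp]:
  "crossing_list ((i, Cap) # w) = map Suc (crossing_list w)"
  "crossing_list ((i, Cup) # w) = map Suc (crossing_list w)"
  "crossing_list ((i, Cross c) # w) = 0 # map Suc (crossing_list w)"
  by (simp_all add: crossing_list_Cons)

lemma resolve_Cons:
  "resolve (x # w) r = map_prod id (map_brick (\<lambda>_. r 0)) x # resolve w (r \<circ> Suc)"
proof -
  have "[0..<length (x # w)] = 0 # map Suc [0..<length w]"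
    by (simp add: upt_conv_Cons map_Suc_upt del: upt_Suc)
  then show ?thesis by (simp add: resolve_def)
qed

lemma resolve_fill: "resolve w r = fill w (map r (crossing_list w))"
proof (induction w arbitrary: r)
  case (Cons x w)
  then show ?case
    by (cases x; cases "snd x") (simp_all add: resolve_Cons o_def)
qed (simp add: resolve_def)

lemma length_crossing_list_append [simp]:
  "length (crossing_list (x @ y)) = length (crossing_list x) + length (crossing_list y)"
  by (induction x) (auto simp: crossing_list_Cons)

lemma length_crossing_list_translate [simp]:
  "length (crossing_list (translate k w)) = length (crossing_list w)"
  by (induction w) (auto simp: crossing_list_Cons)

lemma fill_append:
  "length ls = length (crossing_list x) \<Longrightarrow> fill (x @ y) (ls @ ls') = fill x ls @ fill y ls'"
proof (induction x arbitrary: ls)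
  case (Cons a x)
  obtain i b where a: "a = (i, b)" by (cases a)
  show ?case
  proof (cases b)
    case (Cross c)
    then obtain l ls1 where "ls = l # ls1" using Cons(2) a by (cases ls) auto
    then show ?thesis using Cons a Cross by simp
  qed (use Cons a in auto)
qed simp

lemma fill_translate: "fill (translate k w) ls = translate k (fill w ls)"
  by (induction w ls rule: fill.induct) auto

lemma shadow_of_simps [simp]:
  "shadow_of [] = []"
  "shadow_of ((i, b) # w) = (i, map_brick (\<lambda>_. ()) b) # shadow_of w"
  "shadow_of (x @ y) = shadow_of x @ shadow_of y"
  "shadow_of (translate k w) = translate k (shadow_of w)"
  by (auto simp: shadow_of_def translate_def)

lemma length_crossing_list_twists [simp]:
  "length (crossing_list (shadow_of (twists tw))) = length tw"
proof (induction tw rule: rev_induct)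
  case (snoc x tw)
  then show ?case
    by (cases x; cases "fst x") (auto simp: twists_def twist_def bottom_twist_def right_twist_def)
qed (simp add: twists_def)

text \<open>Every twist puts its crossing below the earlier ones, and the caps added on top contain
  none, so the order of height is the order of twisting.\<close>

lemma fill_twists:
  "length ls = length tw \<Longrightarrow> fill (shadow_of (twists tw)) ls = twists (zip (map fst tw) ls)"
proof (induction tw arbitrary: ls rule: rev_induct)
  case Nil
  then show ?case by (simp add: twists_def)
next
  case (snoc x tw)
  obtain k c where x: "x = (k, c)" by (cases x)
  obtain ls' l where ls: "ls = ls' @ [l]" "length ls' = length tw"
    using snoc(2) by (cases ls rule: rev_cases) auto
  have *: "twists (zs @ [z]) = twist z (twists zs)" for zs z by (simp add: twists_def)
  show ?case
    using snoc(1)[OF ls(2)] ls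
    by (simp add: * x twist_def bottom_twist_def right_twist_def fill_append)
qed

lemma resolve_numerator_closure:
  "resolve (shadow_of (numerator_closure (twists tw))) r = numerator_closure (twists (zip (map fst tw)
    (map r (crossing_list (shadow_of (numerator_closure (twists tw)))))))"
  (is "resolve ?S r = numerator_closure (twists (zip _ ?ls))")
proof -
  have "length ?ls = length tw" by (simp add: numerator_closure_def)
  then show ?thesis
    using fill_append[of ?ls "shadow_of (twists tw)" _ "[]"]
    unfolding resolve_fill by (simp add: numerator_closure_def fill_twists del: map_map)
qed

lemma resolve_denominator_closure:
  "resolve (shadow_of (denominator_closure (twists tw))) r = denominator_closure (twists (zip (map fst tw)
    (map r (crossing_list (shadow_of (denominator_closure (twists tw)))))))"
  (is "resolve ?S r = denominator_closure (twists (zip _ ?ls))")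
proof -
  have "length ?ls = length tw" by (simp add: denominator_closure_def)
  then show ?thesis
    using fill_append[of ?ls "translate 1 (shadow_of (twists tw))" _ "[]"]
    unfolding resolve_fill by (simp add: denominator_closure_def fill_twists fill_translate del: map_map)
qed

lemma length_crossing_list_closure:
  "length (crossing_list (shadow_of (numerator_closure (twists tw)))) = length tw"
  "length (crossing_list (shadow_of (denominator_closure (twists tw)))) = length tw"
  by (simp_all add: numerator_closure_def denominator_closure_def)

section \<open>The strategies of both players\<close>

text \<open>The ends are swapped and swapped back, and with opposite labels the same strand is on
  top both times, so the parity changes twice or not at all.\<close>

lemma fold_twist_colours_doubled:
  "\<forall>(k, c, c') \<in> set ps. c' = (\<not> c) \<Longrightarrow> fold twist_colours (doubled ps) (ne, sw, se, v) = (ne, sw, se, v)"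
proof (induction ps arbitrary: v)
  case (Cons x ps)
  obtain k c where x: "x = (k, c, \<not> c)" using Cons(2) by (cases x) auto
  have "twist_colours (k, \<not> c) (twist_colours (k, c) (ne, sw, se, v)) = (ne, sw, se, v)"
    by (cases k; cases c) auto
  then show ?case using Cons by (simp add: x del: twist_colours.simps)
qed simp

lemma fold_twist_colours_doubled_endpoints:
  "\<exists>v'. fold twist_colours (doubled ps) (ne, sw, se, v) = (ne, sw, se, v')"
proof (induction ps arbitrary: v)
  case (Cons x ps)
  obtain k c c' where x: "x = (k, c, c')" by (cases x)
  have "\<exists>v'. twist_colours (k, c') (twist_colours (k, c) (ne, sw, se, v)) = (ne, sw, se, v')"
    by (cases k) auto
  then obtain v' where "twist_colours (k, c') (twist_colours (k, c) (ne, sw, se, v)) = (ne, sw, se, v')" ..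
  with Cons[of v'] show ?case by (simp add: x del: twist_colours.simps)
qed simp

lemma fold_twist_colours_right:
  "\<forall>x\<in>set tw. \<not> fst x \<Longrightarrow> \<exists>v'. fold twist_colours tw (b, sw, b, v) = (b, sw, b, v')"
proof (induction tw arbitrary: v)
  case (Cons x tw)
  then obtain c where x: "x = (False, c)" by (cases x) auto
  obtain v' where "twist_colours x (b, sw, b, v) = (b, sw, b, v')" by (simp add: x)
  with Cons show ?case by (simp del: twist_colours.simps)
qed simp

text \<open>A colouring of the numerator closure by both colours starts with NE coloured
  \<open>\<not> a\<close> and must end with \<open>a\<close>. Here NE ends as it began: bottom
  twists do not touch it, doubled twists restore it, and right twists alone exchange equal
  colours.\<close>

lemma numerator_not_two_component:
  assumes "two_component_link (numerator_closure (twists tw))"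
  shows "\<not> (\<forall>x\<in>set tw. \<not> fst x)" "tw \<noteq> doubled ps" "tw \<noteq> (True, c) # doubled ps @ [(True, c')]"
proof -
  obtain a y v where *: "fold twist_colours tw (\<not> a, a, \<not> a, False) = (a, y, y, v)"
    using two_component_colouring[OF assms] colouring_numerator_closure by blast
  show "\<not> (\<forall>x\<in>set tw. \<not> fst x)"
    using fold_twist_colours_right[of tw "\<not> a" a False] * by auto
  show "tw \<noteq> doubled ps"
    using fold_twist_colours_doubled_endpoints[of ps "\<not> a" a "\<not> a" False] * by auto
  obtain v\<^sub>1 where 1: "twist_colours (True, c) (\<not> a, a, \<not> a, False) = (\<not> a, \<not> a, a, v\<^sub>1)"
    by simp
  obtain v\<^sub>2 where 2: "fold twist_colours (doubled ps) (\<not> a, \<not> a, a, v\<^sub>1) = (\<not> a, \<not> a, a, v\<^sub>2)"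
    using fold_twist_colours_doubled_endpoints by blast
  show "tw \<noteq> (True, c) # doubled ps @ [(True, c')]"
  proof
    assume "tw = (True, c) # doubled ps @ [(True, c')]"
    then have "fold twist_colours tw (\<not> a, a, \<not> a, False) = twist_colours (True, c') (\<not> a, \<not> a, a, v\<^sub>2)"
      using 1 2 by (simp del: twist_colours.simps)
    then show False using * by simp
  qed
qed

text \<open>The denominator closure needs \<open>a\<close> at SW in the end. The first twist moves
  \<open>a\<close> to SE, the pairs leave it there, and the last twist takes it to NE.\<close>

lemma denominator_not_two_component:
  assumes "two_component_link (denominator_closure (twists tw))"
  shows "tw \<noteq> (True, c) # doubled ps @ [(False, c')]"
proof
  assume tw: "tw = (True, c) # doubled ps @ [(False, c')]"
  obtain a y v where *: "fold twist_colours tw (\<not> a, a, \<not> a, False) = (y, a, y, v)"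
    using two_component_colouring[OF assms] colouring_denominator_closure by blast
  obtain v\<^sub>1 where 1: "twist_colours (True, c) (\<not> a, a, \<not> a, False) = (\<not> a, \<not> a, a, v\<^sub>1)"
    by simp
  obtain v\<^sub>2 where 2: "fold twist_colours (doubled ps) (\<not> a, \<not> a, a, v\<^sub>1) = (\<not> a, \<not> a, a, v\<^sub>2)"
    using fold_twist_colours_doubled_endpoints by blast
  have "fold twist_colours tw (\<not> a, a, \<not> a, False) = twist_colours (False, c') (\<not> a, \<not> a, a, v\<^sub>2)"
    using 1 2 tw by (simp del: twist_colours.simps)
  then show False using * by simp
qed

text \<open>SW and SE have different colours before the special pair, so exactly one of its
  crossings has \<open>True\<close> above \<open>False\<close>. All other pairs contribute nothing,
  and the total is odd.\<close>

lemma unsplittable_doubled: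
  assumes "\<forall>(k, c, c') \<in> set (ps @ ps'). c' = (\<not> c)"
  shows "\<not> splittable (denominator_closure (twists (doubled (ps @ (True, c, c) # ps'))))"
proof
  assume "splittable (denominator_closure (twists (doubled (ps @ (True, c, c) # ps'))))"
  from colouring_denominator_closure[OF splittable_colouring[OF this]] obtain a y where
    "fold twist_colours (doubled (ps @ (True, c, c) # ps')) (\<not> a, a, \<not> a, False) = (y, a, y, False)"
    by blast
  moreover have "twist_colours (True, c) (twist_colours (True, c) (\<not> a, a, \<not> a, False)) = (\<not> a, a, \<not> a, True)"
    by (cases a; cases c) auto
  then have "fold twist_colours (doubled (ps @ (True, c, c) # ps')) (\<not> a, a, \<not> a, False) = (\<not> a, a, \<not> a, True)"
    using assms by (simp add: fold_twist_colours_doubled del: twist_colours.simps)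
  ultimately show False by simp
qed

lemma fold_twist_colours_enclosed:
  assumes "\<forall>(k, c, c') \<in> set ps. c' = (\<not> c)"
  shows "fold twist_colours ((True, c) # doubled ps @ [(k, c)]) (\<not> a, a, \<not> a, False) =
    (if k then (\<not> a, a, \<not> a, True) else (a, \<not> a, \<not> a, True))"
proof -
  \<comment> \<open>\<open>c \<noteq> a\<close> is the colour of the overstrand, which decides the
    parity as the strands differ in colour. At the last crossing the same label puts the other
    colour on top, for either kind \<open>k\<close>.\<close>
  have "twist_colours (True, c) (\<not> a, a, \<not> a, False) = (\<not> a, \<not> a, a, c \<noteq> a)"
    by (cases a; cases c) auto
  moreover have "twist_colours (k, c) (\<not> a, \<not> a, a, c \<noteq> a) =
      (if k then (\<not> a, a, \<not> a, True) else (a, \<not> a, \<not> a, True))"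
    by (cases a; cases c; cases k) auto
  ultimately show ?thesis
    using assms by (simp add: fold_twist_colours_doubled del: twist_colours.simps)
qed

lemma unsplittable_enclosed_doubled:
  assumes "\<forall>(k, c, c') \<in> set ps. c' = (\<not> c)"
  shows "\<not> splittable (denominator_closure (twists ((True, c) # doubled ps @ [(True, c)])))"
    and "\<not> splittable (numerator_closure (twists ((True, c) # doubled ps @ [(False, c)])))"
proof -
  show "\<not> splittable (denominator_closure (twists ((True, c) # doubled ps @ [(True, c)])))"
  proof
    assume "splittable (denominator_closure (twists ((True, c) # doubled ps @ [(True, c)])))"
    from colouring_denominator_closure[OF splittable_colouring[OF this]] show False
      using fold_twist_colours_enclosed[OF assms, of c True] by (metis Pair_inject)
  qed
  show "\<not> splittable (numerator_closure (twists ((True, c) # doubled ps @ [(False, c)])))"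
  proof
    assume "splittable (numerator_closure (twists ((True, c) # doubled ps @ [(False, c)])))"
    from colouring_numerator_closure[OF splittable_colouring[OF this]] show False
      using fold_twist_colours_enclosed[OF assms, of c False] by (metis Pair_inject)
  qed
qed

text \<open>Once the inner pairs are gone, two bottom twists cancel as a pair of their own. A bottom
  and a right twist cancel only with the help of the closing arcs.\<close>

lemma splittable_enclosed_doubled:
  assumes "\<forall>(k, c, c') \<in> set ps. c' = (\<not> c)"
  shows "splittable (denominator_closure (twists ((True, c) # doubled ps @ [(True, \<not> c)])))"
    and "splittable (numerator_closure (twists ((True, c) # doubled ps @ [(False, \<not> c)])))"
proof -
  have "tangle_equiv 2 2 (twists ((True, c) # doubled ps @ [(True, \<not> c)])) (twists (doubled [(True, c, \<not> c)]))"
    using twists_enclosed_doubled[OF assms] by simp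
  also have "tangle_equiv 2 2 \<dots> []" by (rule twists_doubled) simp
  finally show "splittable (denominator_closure (twists ((True, c) # doubled ps @ [(True, \<not> c)])))"
    by (rule splittable_denominator_closure)
  show "splittable (numerator_closure (twists ((True, c) # doubled ps @ [(False, \<not> c)])))"
    by (rule splittable_numerator_closure[OF twists_enclosed_doubled[OF assms]])
qed

section \<open>The pairs of crossings and the two replies\<close>

lemma even_length_pairs:
  "length xs = 2 * m \<Longrightarrow> \<exists>qs. xs = concat (map (\<lambda>(x, y). [x, y]) qs) \<and> length qs = m"
proof (induction m arbitrary: xs)
  case (Suc m)
  then obtain x y xs' where xs: "xs = x # y # xs'" "length xs' = 2 * m"
    by (auto simp: length_Suc_conv)
  with Suc(1) obtain qs where "xs' = concat (map (\<lambda>(x, y). [x, y]) qs)" "length qs = m" by blast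
  with xs show ?case by (intro exI[of _ "(x, y) # qs"]) auto
qed simp

lemma zip_pairs:
  "length ks = length qs \<Longrightarrow>
    zip (concat (map (\<lambda>k. [k, k]) ks)) (map r (concat (map (\<lambda>(x, y). [x, y]) qs))) =
    doubled (map2 (\<lambda>k (x, y). (k, r x, r y)) ks qs)"
  by (induction ks qs rule: list_induct2) (auto simp: doubled_def)

lemma zip_append_pairs:
  assumes "length ks = length qs"
  shows "zip (concat (map (\<lambda>k. [k, k]) ks) @ ks') (map r (concat (map (\<lambda>(x, y). [x, y]) qs) @ L)) =
    doubled (map2 (\<lambda>k (x, y). (k, r x, r y)) ks qs) @ zip ks' (map r L)"
proof -
  have "length (concat (map (\<lambda>k. [k, k]) ks)) = length (concat (map (\<lambda>(x, y). [x, y]) qs))"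
    using assms by (induction ks qs rule: list_induct2) auto
  then show ?thesis using zip_pairs[OF assms] by simp
qed

lemma opposite_labels_doubled:
  assumes "\<forall>(x, y)\<in>set qs. r y = (\<not> r x)"
  shows "\<forall>(k, c, c') \<in> set (map2 (\<lambda>k (x, y). (k, r x, r y)) ks qs). c' = (\<not> c)"
  using assms by (auto dest!: set_zip_rightD)

lemma second_player_wins_even:
  assumes ks: "map fst tw = concat (map (\<lambda>k. [k, k]) ks)" and True: "True \<in> set ks"
  shows "has_winning_strategy (shadow_of (denominator_closure (twists tw))) (opponent P) P"
proof -
  let ?S = "shadow_of (denominator_closure (twists tw))"
  let ?L = "crossing_list ?S"
  have "length (concat (map (\<lambda>k. [k, k]) ks)) = 2 * length ks" by (induction ks) auto
  then have "length ?L = 2 * length ks"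
    using ks length_crossing_list_closure(2)[of tw] by (metis length_map)
  then obtain qs where L: "?L = concat (map (\<lambda>(x, y). [x, y]) qs)" and len: "length ks = length qs"
    by (metis even_length_pairs)
  have dist: "distinct (concat (map (\<lambda>(x, y). [x, y]) qs))"
    and cross: "set (concat (map (\<lambda>(x, y). [x, y]) qs)) = crossings ?S"
    using distinct_crossing_list[of ?S] set_crossing_list[of ?S] by (simp_all add: L)
  have res: "resolve ?S r = denominator_closure (twists (doubled (map2 (\<lambda>k (x, y). (k, r x, r y)) ks qs)))" for r
    unfolding resolve_denominator_closure ks L zip_pairs[OF len] ..
  show ?thesis
  proof (cases P)
    case Unlinker
    show ?thesis
    proof (rule pairing_strategy[OF dist cross, where d = "\<lambda>_. True"])
      fix r assume "\<forall>(x, y)\<in>set qs. r y = (r x \<noteq> True)"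
      then have "\<forall>(x, y)\<in>set qs. r y = (\<not> r x)" by simp
      then show "wins P (resolve ?S r)"
        unfolding Unlinker wins.simps res
        by (intro splittable_denominator_closure twists_doubled opposite_labels_doubled)
    qed
  next
    case Linker
    \<comment> \<open>The special pair must consist of bottom twists; \<open>length k1\<close> is
      its rank among the pairs.\<close>
    from True obtain k1 k2 where k12: "ks = k1 @ True # k2" by (auto dest: split_list)
    define q1 q2 where "q1 = take (length k1) qs" and "q2 = drop (Suc (length k1)) qs"
    obtain x0 y0 where "qs ! length k1 = (x0, y0)" by (cases "qs ! length k1")
    moreover have "length k1 < length qs" using len k12 by simp
    ultimately have q12: "qs = q1 @ (x0, y0) # q2" "length q1 = length k1"
      using id_take_nth_drop[of "length k1" qs] by (simp_all add: q1_def q2_def)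
    \<comment> \<open>\<open>d\<close> fails only at \<open>x0\<close>: the Linker repeats the label
      in that pair and negates it in all others, which start at different crossings.\<close>
    show ?thesis
    proof (rule pairing_strategy[OF dist cross, where d = "\<lambda>x. x \<noteq> x0"])
      fix r assume r: "\<forall>(x, y)\<in>set qs. r y = (r x \<noteq> (x \<noteq> x0))"
      have opp: "\<forall>(x, y)\<in>set (q1 @ q2). r y = (\<not> r x)"
      proof clarify
        fix x y assume xy: "(x, y) \<in> set (q1 @ q2)"
        then have "x \<noteq> x0" using dist unfolding q12 by auto
        then show "r y = (\<not> r x)" using bspec[OF r, of "(x, y)"] xy by (auto simp: q12)
      qed
      have "r y0 = r x0" using bspec[OF r, of "(x0, y0)"] by (simp add: q12)
      then have eq: "map2 (\<lambda>k (x, y). (k, r x, r y)) ks qs =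
          map2 (\<lambda>k (x, y). (k, r x, r y)) k1 q1 @ (True, r x0, r x0) #
            map2 (\<lambda>k (x, y). (k, r x, r y)) k2 q2"
        using q12(2) by (simp add: q12(1) k12)
      have "\<forall>(k, c, c') \<in> set (map2 (\<lambda>k (x, y). (k, r x, r y)) k1 q1 @
          map2 (\<lambda>k (x, y). (k, r x, r y)) k2 q2). c' = (\<not> c)"
        using opposite_labels_doubled[OF opp, of "k1 @ k2"] by (simp only: zip_append[OF q12(2)[symmetric]] map_append)
      then show "wins P (resolve ?S r)"
        unfolding Linker wins.simps res eq by (rule unsplittable_doubled)
    qed
  qed
qed

text \<open>\<open>ks\<close> may be empty, so the first and the last crossing are the only pair
  certain to exist, and it is there that the Linker repeats the label. The closure follows the kind
  \<open>k\<close> of the last crossing.\<close>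

lemma second_player_wins_enclosed:
  assumes ks: "map fst tw = True # concat (map (\<lambda>k. [k, k]) ks) @ [k]"
    and D: "D = (if k then denominator_closure (twists tw) else numerator_closure (twists tw))"
  shows "has_winning_strategy (shadow_of D) (opponent P) P"
proof -
  let ?S = "shadow_of D"
  let ?L = "crossing_list ?S"
  have "length (concat (map (\<lambda>k. [k, k]) ks)) = 2 * length ks" by (induction ks) auto
  then have "length (map fst tw) = 2 + 2 * length ks" using ks by simp
  then have "length ?L = 2 + 2 * length ks"
    by (simp add: D length_crossing_list_closure)
  then obtain x0 M y0 where L0: "?L = x0 # M @ [y0]" and M: "length M = 2 * length ks"
    by (cases ?L; cases "tl ?L" rule: rev_cases) auto
  obtain qs where qs: "M = concat (map (\<lambda>(x, y). [x, y]) qs)" and len: "length ks = length qs"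
    using even_length_pairs[OF M] by metis
  let ?qs = "(x0, y0) # qs"
  have dist: "distinct (concat (map (\<lambda>(x, y). [x, y]) ?qs))"
    and cross: "set (concat (map (\<lambda>(x, y). [x, y]) ?qs)) = crossings ?S"
    using distinct_crossing_list[of ?S] set_crossing_list[of ?S] by (auto simp: L0 qs)
  define ps where "ps r = map2 (\<lambda>k (x, y). (k, r x, r y)) ks qs" for r :: "nat \<Rightarrow> bool"
  have "resolve ?S r = (if k then denominator_closure else numerator_closure)
      (twists (zip (map fst tw) (map r ?L)))" for r
    unfolding D by (simp add: resolve_numerator_closure resolve_denominator_closure del: map_map)
  moreover have "zip (map fst tw) (map r ?L) = (True, r x0) # doubled (ps r) @ [(k, r y0)]" for r
    unfolding ks L0 qs using zip_append_pairs[OF len, of "[k]" r "[y0]"] by (simp add: ps_def)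
  ultimately have res: "resolve ?S r = (if k then denominator_closure else numerator_closure)
      (twists ((True, r x0) # doubled (ps r) @ [(k, r y0)]))" for r
    by simp
  have x0: "x \<noteq> x0" if "(x, y) \<in> set qs" for x y
    using that dist by auto
  show ?thesis
  proof (cases P)
    case Unlinker
    show ?thesis
    proof (rule pairing_strategy[OF dist cross, where d = "\<lambda>_. True"])
      fix r assume r: "\<forall>(x, y)\<in>set ?qs. r y = (r x \<noteq> True)"
      then have "\<forall>(k, c, c') \<in> set (ps r). c' = (\<not> c)"
        unfolding ps_def by (intro opposite_labels_doubled) simp
      moreover have "r y0 = (\<not> r x0)" using r by simp
      ultimately show "wins P (resolve ?S r)"
        unfolding Unlinker wins.simps res using splittable_enclosed_doubled[of "ps r" "r x0"]
        by (cases k) simp_all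
    qed
  next
    case Linker
    show ?thesis
    proof (rule pairing_strategy[OF dist cross, where d = "\<lambda>x. x \<noteq> x0"])
      fix r assume r: "\<forall>(x, y)\<in>set ?qs. r y = (r x \<noteq> (x \<noteq> x0))"
      have "\<forall>(x, y)\<in>set qs. r y = (\<not> r x)"
      proof clarify
        fix x y assume "(x, y) \<in> set qs"
        then show "r y = (\<not> r x)" using bspec[OF r, of "(x, y)"] x0[of x y] by simp
      qed
      then have "\<forall>(k, c, c') \<in> set (ps r). c' = (\<not> c)"
        unfolding ps_def by (rule opposite_labels_doubled)
      moreover have "r y0 = r x0" using r by simp
      ultimately show "wins P (resolve ?S r)"
        unfolding Linker wins.simps res using unsplittable_enclosed_doubled[of "ps r" "r x0"]
        by (cases k) simp_all
    qed
  qed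
qed

section \<open>From syllables to paired twists\<close>

lemma pairs_doubled:
  "map fst tw = concat (map (\<lambda>k. [k, k]) ks) \<Longrightarrow> \<exists>ps. tw = doubled ps"
proof (induction ks arbitrary: tw)
  case Nil
  then show ?case by (intro exI[of _ "[]"]) simp
next
  case (Cons k ks)
  then obtain c c' tw' where tw: "tw = (k, c) # (k, c') # tw'" "map fst tw' = concat (map (\<lambda>k. [k, k]) ks)"
    by (auto simp: map_eq_Cons_conv)
  from Cons(1)[OF tw(2)] obtain ps where "tw' = doubled ps" ..
  then show ?case by (intro exI[of _ "(k, c, c') # ps"]) (simp add: tw(1))
qed

lemma enclosed_pairs_doubled:
  assumes "map fst tw = True # concat (map (\<lambda>k. [k, k]) ks) @ [k]"
  shows "\<exists>c ps c'. tw = (True, c) # doubled ps @ [(k, c')]"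
proof -
  from assms obtain c tw' where 1: "tw = (True, c) # tw'" "map fst tw' = concat (map (\<lambda>k. [k, k]) ks) @ [k]"
    by (auto simp: map_eq_Cons_conv)
  from 1(2) obtain tw'' c' where 2: "tw' = tw'' @ [(k, c')]" "map fst tw'' = concat (map (\<lambda>k. [k, k]) ks)"
    by (cases tw' rule: rev_cases) auto
  from pairs_doubled[OF 2(2)] 1(1) 2(1) show ?thesis by auto
qed

definition syllables :: "(nat \<Rightarrow> int) \<Rightarrow> nat list \<Rightarrow> (bool \<times> bool) list" where
  "syllables a is = concat (map (\<lambda>i. replicate (nat \<bar>a i\<bar>) (odd i, a i > 0)) is)"

lemma rational_tangle_twists: "rational_tangle (map a [1..<n + 1]) = twists (syllables a [1..<n + 1])"
proof -
  have "fold add_syllable (map (\<lambda>i. (i, a i)) is) T = fold twist (syllables a is) T" for "is" T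
  proof (induction "is" arbitrary: T)
    case (Cons i "is")
    have "add_syllable (i, a i) T = fold twist (replicate (nat \<bar>a i\<bar>) (odd i, a i > 0)) T"
      by (simp add: add_syllable_def twist_def fold_replicate)
    with Cons show ?case by (simp add: syllables_def)
  qed (simp add: syllables_def)
  moreover have "enumerate 1 (map a [1..<n + 1]) = map (\<lambda>i. (i, a i)) [1..<n + 1]"
    by (rule enumerate_map_upt)
  ultimately show ?thesis by (simp only: rational_tangle_def twists_def)
qed

lemma syllables_simps:
  "syllables a [] = []"
  "syllables a (i # is) = replicate (nat \<bar>a i\<bar>) (odd i, a i > 0) @ syllables a is"
  "syllables a (is @ js) = syllables a is @ syllables a js"
  by (simp_all add: syllables_def)

lemma replicate_pairs: "replicate (2 * m) k = concat (map (\<lambda>k. [k, k]) (replicate m k))"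
  by (induction m) auto

text \<open>Only kinds are recorded, since the shadow forgets the labels. A nonzero even syllable of
  odd index yields at least one of the bottom pairs that the Linker needs.\<close>

lemma even_syllables_kinds:
  assumes "\<forall>i\<in>set is. even (a i)"
  shows "\<exists>ks. map fst (syllables a is) = concat (map (\<lambda>k. [k, k]) ks) \<and>
    ((\<exists>i\<in>set is. odd i \<and> a i \<noteq> 0) \<longrightarrow> True \<in> set ks)"
  using assms
proof (induction "is")
  case (Cons i "is")
  then obtain ks where ks: "map fst (syllables a is) = concat (map (\<lambda>k. [k, k]) ks)"
    "(\<exists>i\<in>set is. odd i \<and> a i \<noteq> 0) \<longrightarrow> True \<in> set ks" by auto
  obtain m where m: "nat \<bar>a i\<bar> = 2 * m"
    using Cons(2) by (metis dvd_def even_abs_add_iff even_nat_iff abs_ge_zero dvd_abs_iff list.set_intros(1))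
  show ?case
  proof (intro exI[of _ "replicate m (odd i) @ ks"] conjI impI)
    show "map fst (syllables a (i # is)) = concat (map (\<lambda>k. [k, k]) (replicate m (odd i) @ ks))"
      using replicate_pairs[of m "odd i"] by (simp add: syllables_simps ks(1) m)
    assume "\<exists>j\<in>set (i # is). odd j \<and> a j \<noteq> 0"
    then show "True \<in> set (replicate m (odd i) @ ks)" using ks(2) m by auto
  qed
qed (simp add: syllables_simps)

lemma enclosed_syllables_kinds:
  assumes "n \<ge> 2" "odd (a 1)" "odd (a n)" "\<forall>i\<in>{2..n - 1}. even (a i)"
  shows "\<exists>ks. map fst (syllables a [1..<n + 1]) = True # concat (map (\<lambda>k. [k, k]) ks) @ [odd n]"
proof -
  have odd: "\<exists>m. nat \<bar>x\<bar> = Suc (2 * m)" if "odd x" for x :: int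
  proof -
    from that have "odd (nat \<bar>x\<bar>)" by (simp add: even_nat_iff)
    then obtain m where "nat \<bar>x\<bar> = 2 * m + 1" by (rule oddE)
    then show ?thesis by auto
  qed
  obtain m\<^sub>1 where m1: "nat \<bar>a 1\<bar> = Suc (2 * m\<^sub>1)" using odd assms(2) by blast
  obtain m\<^sub>2 where m2: "nat \<bar>a n\<bar> = Suc (2 * m\<^sub>2)" using odd assms(3) by blast
  have "\<forall>i\<in>set [2..<n]. even (a i)" using assms(4) by auto
  from even_syllables_kinds[OF this] obtain ks where
    ks: "map fst (syllables a [2..<n]) = concat (map (\<lambda>k. [k, k]) ks)" by blast
  have upt: "[1..<n + 1] = 1 # [2..<n] @ [n]"
    using assms(1) by (simp add: upt_conv_Cons numeral_2_eq_2)
  \<comment> \<open>The unpaired crossing of the last syllable is split off at its end, whereas that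
    of the first is split off at its front; thus every other pair stays within one syllable.\<close>
  have "replicate (nat \<bar>a n\<bar>) (odd n) = replicate (2 * m\<^sub>2) (odd n) @ [odd n]"
    by (simp add: m2 replicate_append_same)
  then have "map fst (syllables a [1..<n + 1]) =
      True # concat (map (\<lambda>k. [k, k]) (replicate m\<^sub>1 True @ ks @ replicate m\<^sub>2 (odd n))) @ [odd n]"
    using replicate_pairs[of m\<^sub>1 True] replicate_pairs[of m\<^sub>2 "odd n"]
    unfolding upt by (simp add: syllables_simps ks m1[unfolded One_nat_def])
  then show ?thesis ..
qed

theorem theorem1p1:
  fixes a :: "nat \<Rightarrow> int" and n :: nat and D :: diagram
  assumes "n \<ge> 1"
    and "D = numerator_closure (rational_tangle (map a [1..<n+1])) \<or>
         D = denominator_closure (rational_tangle (map a [1..<n+1]))"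
    and "two_component_link D"
  shows "((\<forall>k. 2 * k + 1 \<le> n \<longrightarrow> a (2 * k + 1) = 0) \<longrightarrow>
            (\<forall>h. complete_play (shadow_of D) h \<longrightarrow> wins Unlinker (outcome (shadow_of D) h))) \<and>
         (((\<exists>k. 2 * k + 1 \<le> n \<and> a (2 * k + 1) \<noteq> 0) \<and> (\<forall>i\<in>{1..n}. even (a i)) \<or>
           n = 2 \<and> odd (a 1) \<and> odd (a 2) \<or>
           n \<ge> 3 \<and> odd (a 1) \<and> odd (a n) \<and> (\<forall>i\<in>{2..n-1}. even (a i))) \<longrightarrow>
            (\<forall>second. has_winning_strategy (shadow_of D) (opponent second) second))"
proof -
  define tw where "tw = syllables a [1..<n + 1]"
  have D: "D = numerator_closure (twists tw) \<or> D = denominator_closure (twists tw)"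
    using assms(2) unfolding rational_tangle_twists tw_def .
  note numerator = numerator_not_two_component[of tw]
  note denominator = denominator_not_two_component[of tw]
  have "wins Unlinker (outcome (shadow_of D) h)"
    if zero: "\<forall>k. 2 * k + 1 \<le> n \<longrightarrow> a (2 * k + 1) = 0" for h
  proof -
    have "a i = 0" if "i \<in> set [1..<n + 1]" "odd i" for i
      using that zero by (auto elim!: oddE)
    then have tw: "\<forall>x\<in>set tw. \<not> fst x" unfolding tw_def syllables_def by fastforce
    \<comment> \<open>The number of components excludes the numerator closure. What remains splits
      for every list \<open>ls\<close> of labels, hence after every play.\<close>
    then have "D = denominator_closure (twists tw)" using D numerator(1) assms(3) by blast
    moreover have "splittable (denominator_closure (twists (zip (map fst tw) ls)))" for ls
      using tw by (intro splittable_denominator_closure twists_right) (auto dest!: set_zip_leftD)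
    ultimately show ?thesis
      unfolding outcome_def by (simp only: resolve_denominator_closure wins.simps)
  qed
  moreover have "has_winning_strategy (shadow_of D) (opponent P) P"
    if ex: "\<exists>k. 2 * k + 1 \<le> n \<and> a (2 * k + 1) \<noteq> 0" and even: "\<forall>i\<in>{1..n}. even (a i)" for P
  proof -
    obtain k where "2 * k + 1 \<le> n" "a (2 * k + 1) \<noteq> 0" using ex by blast
    then have "\<exists>i\<in>set [1..<n + 1]. odd i \<and> a i \<noteq> 0"
      by (intro bexI[of _ "2 * k + 1"]) auto
    moreover have "\<forall>i\<in>set [1..<n + 1]. even (a i)" using even by auto
    ultimately obtain ks where ks: "map fst tw = concat (map (\<lambda>k. [k, k]) ks)" "True \<in> set ks"
      using even_syllables_kinds[of "[1..<n + 1]" a] unfolding tw_def by blast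
    obtain ps where "tw = doubled ps" using pairs_doubled[OF ks(1)] by blast
    then have "D = denominator_closure (twists tw)" using D numerator(2) assms(3) by blast
    then show ?thesis using second_player_wins_even[OF ks] by simp
  qed
  moreover have "has_winning_strategy (shadow_of D) (opponent P) P"
    if odd: "n \<ge> 2" "odd (a 1)" "odd (a n)" "\<forall>i\<in>{2..n - 1}. even (a i)" for P
  proof -
    obtain ks where ks: "map fst tw = True # concat (map (\<lambda>k. [k, k]) ks) @ [odd n]"
      using enclosed_syllables_kinds[OF odd] unfolding tw_def by (rule exE)
    obtain c ps c' where tw: "tw = (True, c) # doubled ps @ [(odd n, c')]"
      using enclosed_pairs_doubled[OF ks] by blast
    have "D = (if odd n then denominator_closure (twists tw) else numerator_closure (twists tw))"
    proof (cases "odd n")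
      case True
      then have "tw = (True, c) # doubled ps @ [(True, c')]" using tw by simp
      then have "D \<noteq> numerator_closure (twists tw)" using numerator(3) assms(3) by blast
      with D True show ?thesis by simp
    next
      case False
      then have "tw = (True, c) # doubled ps @ [(False, c')]" using tw by simp
      then have "D \<noteq> denominator_closure (twists tw)" using denominator assms(3) by blast
      with D False show ?thesis by simp
    qed
    then show ?thesis by (rule second_player_wins_enclosed[OF ks])
  qed
  \<comment> \<open>For \<open>n = 2\<close> there are no inner syllables, so (b) and (c) are both
    instances of the case \<open>n \<ge> 2\<close>.\<close>
  moreover have "{2..2 - 1 :: nat} = {}" by simp
  ultimately show ?thesis by (cases "n = 2") (force, force)
qed

end
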